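(* Let $\Omega\subset\mathbb{C}^n$ be a bounded hyperconvex domain, let $u_0,u_1\in\mathcal{PSH}(\Omega)\cap L^\infty(\Omega)$, and let $\widehat u$ be the upper envelope on $\Omega\times\mathcal A$ associated with $u_0,u_1$. Put $\Psi_u(z,\zeta)=(1-\log|\zeta|)\,u_0(z)+\log|\zeta|\,u_1(z)$. Then: (i) $\widehat u=P_{\Omega\times\mathcal A}(\Psi_u)$ on $\Omega\times\mathcal A$; (ii) if $u_0,u_1\in\mathcal{PSH}(\Omega)\cap C(\overline\Omega)$ and $\Omega$ is $B$-regular, then $\widehat u\in C(\overline{\Omega\times\mathcal A})$ (that is, $\widehat u$ extends continuously to the closure) and $\widehat u=\Psi_u$ on $\partial\Omega\times\mathcal A$.
   Context: $\mathcal{PSH}(G)$ denotes the plurisubharmonic (psh) functions on a domain $G$. $\mathcal A=\{\zeta\in\mathbb C: 0<\log|\zeta|<1\}$ and $\mathcal A_j=\{\log|\zeta|=j\}$, $j=0,1$. $W(u_0,u_1)$ is the class of $v\in\mathcal{PSH}(\Omega\times\mathcal A)$ such that $\limsup v(z,\zeta)\le u_j(z)$ as $\zeta\to\mathcal A_j$, for every $z\in\Omega$ and $j=0,1$. The envelope is $\widehat u(z,\zeta)=\sup\{v(z,\zeta): v\in W(u_0,u_1)\}$, which is psh on $\Omega\times\mathcal A$. For a domain $G$ and a measurable function $h$ on $G$ locally bounded from above, $P_G(h)=\left(\sup\{v\in\mathcal{PSH}(G): v\le h\}\right)^*$, where $^*$ is the upper semicontinuous regularization. A bounded domain $\Omega$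 is hyperconvex if there is $\rho\in\mathcal{PSH}(\Omega)$ with $\{z\in\Omega:\rho(z)<c\}\Subset\Omega$ for all $c<0$ (i.e. $\rho(z)\to0$ as $z\to\partial\Omega$). It is $B$-regular if every $p\in\partial\Omega$ has a strong psh barrier, i.e. a function $\rho_p\in\mathcal{PSH}(\Omega)$ with $\sup_\Omega\rho_p=0$ and $\sup_{\Omega\setminus U}\rho_p<0$ for every neighborhood $U$ of $p$ (such a function can be chosen in $\mathcal{PSH}(\Omega)\cap C(\overline\Omega)$); equivalently (Sibony), every $f\in C(\partial\Omega)$ is the boundary value of some $u\in\mathcal{PSH}(\Omega)\cap C(\overline\Omega)$. *)

theory Defs
  imports "HOL-Analysis.Analysis"
begin

definition domain :: "'a::topological_space set \<Rightarrow> bool" where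
  "domain G \<longleftrightarrow> open G \<and> connected G \<and> G \<noteq> {}"

definition usc_on :: "'a::topological_space set \<Rightarrow> ('a \<Rightarrow> ereal) \<Rightarrow> bool" where
  "usc_on G f \<longleftrightarrow> (\<forall>c. openin (top_of_set G) {x \<in> G. f x < c})"

text \<open>Here the limit superior at \<open>x\<close> includes the value at \<open>x\<close> itself.\<close>
definition usc_regularization :: "'a::topological_space set \<Rightarrow> ('a \<Rightarrow> ereal) \<Rightarrow> 'a \<Rightarrow> ereal" where
  "usc_regularization G f x = Limsup (inf (nhds x) (principal G)) f"

text \<open>
  The mean of \<open>f\<close> over the unit circle, as positive part minus negative part.
  It is meaningful whenever \<open>f\<close> is Borel and bounded above on the circle,
  in particular when \<open>f\<close> is upper semicontinuous there with values below \<open>\<infinity>\<close>;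
  it may be \<open>-\<infinity>\<close>.
\<close>
definition circle_mean :: "(complex \<Rightarrow> ereal) \<Rightarrow> ereal" where
  "circle_mean f =
     enn2ereal (\<integral>\<^sup>+t\<in>{0..1}. e2ennreal (f (cis (2 * pi * t))) \<partial>lborel)
     - enn2ereal (\<integral>\<^sup>+t\<in>{0..1}. e2ennreal (- f (cis (2 * pi * t))) \<partial>lborel)"

text \<open>
  Plurisubharmonicity: upper semicontinuity, values in \<open>[-\<infinity>, \<infinity>)\<close>, and the
  sub-mean value inequality on every closed disc \<open>{a + \<lambda> b | \<bar>\<lambda>\<bar> \<le> 1}\<close> of a complex
  line contained in \<open>G\<close>. The complex scalar multiplication \<open>sc\<close> is a parameter because
  the library has no class of complex vector spaces covering both \<open>complex ^ 'n\<close> and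
  \<open>(complex ^ 'n) \<times> complex\<close>. The function that is constantly \<open>-\<infinity>\<close> is admitted.
\<close>
definition psh_on :: "(complex \<Rightarrow> 'a \<Rightarrow> 'a) \<Rightarrow> 'a::real_normed_vector set \<Rightarrow> ('a \<Rightarrow> ereal) \<Rightarrow> bool" where
  "psh_on sc G u \<longleftrightarrow>
     usc_on G u \<and> (\<forall>x\<in>G. u x < \<infinity>) \<and>
     (\<forall>a b. (\<forall>l. cmod l \<le> 1 \<longrightarrow> a + sc l b \<in> G) \<longrightarrow> u a \<le> circle_mean (\<lambda>l. u (a + sc l b)))"

definition prod_scale :: "complex \<Rightarrow> (complex ^ 'n) \<times> complex \<Rightarrow> (complex ^ 'n) \<times> complex" where
  "prod_scale c p = (c *s fst p, c * snd p)"

abbreviation PSH :: "(complex ^ 'n) set \<Rightarrow> (complex ^ 'n \<Rightarrow> ereal) set" where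
  "PSH G \<equiv> {u. psh_on (*s) G u}"

abbreviation PSH_prod :: "((complex ^ 'n) \<times> complex) set \<Rightarrow> ((complex ^ 'n) \<times> complex \<Rightarrow> ereal) set" where
  "PSH_prod G \<equiv> {v. psh_on prod_scale G v}"

text \<open>
  The negativity of \<open>\<rho>\<close> is part of the usual notion: without it, a nonnegative
  constant would satisfy the sublevel set condition vacuously.
\<close>
definition hyperconvex :: "(complex ^ 'n) set \<Rightarrow> bool" where
  "hyperconvex \<Omega> \<longleftrightarrow>
     (\<exists>\<rho>\<in>PSH \<Omega>. (\<forall>z\<in>\<Omega>. \<rho> z < 0) \<and>
        (\<forall>c<0. compact (closure {z \<in> \<Omega>. \<rho> z < c}) \<and> closure {z \<in> \<Omega>. \<rho> z < c} \<subseteq> \<Omega>))"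

text \<open>
  The barriers are taken continuous up to the boundary. The suprema are taken in
  \<open>ereal\<close>, so that the one over an empty set is \<open>-\<infinity>\<close>.
\<close>
definition strong_psh_barrier :: "(complex ^ 'n) set \<Rightarrow> complex ^ 'n \<Rightarrow> (complex ^ 'n \<Rightarrow> real) \<Rightarrow> bool" where
  "strong_psh_barrier \<Omega> p \<rho> \<longleftrightarrow>
     (\<lambda>z. ereal (\<rho> z)) \<in> PSH \<Omega> \<and> continuous_on (closure \<Omega>) \<rho> \<and>
     (SUP z\<in>\<Omega>. ereal (\<rho> z)) = 0 \<and>
     (\<forall>U. open U \<and> p \<in> U \<longrightarrow> (SUP z\<in>\<Omega> - U. ereal (\<rho> z)) < 0)"

definition B_regular :: "(complex ^ 'n) set \<Rightarrow> bool" where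
  "B_regular \<Omega> \<longleftrightarrow> (\<forall>p\<in>frontier \<Omega>. \<exists>\<rho>. strong_psh_barrier \<Omega> p \<rho>)"

text \<open>As \<open>ln 0 = 0\<close> in HOL, the origin is excluded.\<close>
definition annulus :: "complex set" where
  "annulus = {\<zeta>. 0 < ln (cmod \<zeta>) \<and> ln (cmod \<zeta>) < 1}"

text \<open>The filter of \<open>\<zeta> \<in> annulus\<close> approaching the circle \<open>ln \<bar>\<zeta>\<bar> = j\<close>, for \<open>j = 0, 1\<close>.\<close>
definition to_circle :: "real \<Rightarrow> complex filter" where
  "to_circle j = inf (filtercomap (\<lambda>\<zeta>. ln (cmod \<zeta>)) (nhds j)) (principal annulus)"

definition W ::
  "(complex ^ 'n) set \<Rightarrow> (complex ^ 'n \<Rightarrow> real) \<Rightarrow> (complex ^ 'n \<Rightarrow> real) \<Rightarrow>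
    ((complex ^ 'n) \<times> complex \<Rightarrow> ereal) set" where
  "W \<Omega> u0 u1 =
     {v \<in> PSH_prod (\<Omega> \<times> annulus).
        \<forall>z\<in>\<Omega>. Limsup (to_circle 0) (\<lambda>\<zeta>. v (z, \<zeta>)) \<le> ereal (u0 z) \<and>
              Limsup (to_circle 1) (\<lambda>\<zeta>. v (z, \<zeta>)) \<le> ereal (u1 z)}"

definition upper_envelope ::
  "(complex ^ 'n) set \<Rightarrow> (complex ^ 'n \<Rightarrow> real) \<Rightarrow> (complex ^ 'n \<Rightarrow> real) \<Rightarrow>
    (complex ^ 'n) \<times> complex \<Rightarrow> ereal" where
  "upper_envelope \<Omega> u0 u1 p = (SUP v\<in>W \<Omega> u0 u1. v p)"

definition psh_envelope ::
  "((complex ^ 'n) \<times> complex) set \<Rightarrow> ((complex ^ 'n) \<times> complex \<Rightarrow> ereal) \<Rightarrow>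
    (complex ^ 'n) \<times> complex \<Rightarrow> ereal" where
  "psh_envelope G h =
     usc_regularization G (\<lambda>p. SUP v\<in>{v \<in> PSH_prod G. \<forall>q\<in>G. v q \<le> h q}. v p)"

definition \<Psi> ::
  "(complex ^ 'n \<Rightarrow> real) \<Rightarrow> (complex ^ 'n \<Rightarrow> real) \<Rightarrow> (complex ^ 'n) \<times> complex \<Rightarrow> real" where
  "\<Psi> u0 u1 p = (1 - ln (cmod (snd p))) * u0 (fst p) + ln (cmod (snd p)) * u1 (fst p)"

end

theory Submission
  imports Defs "HOL-Complex_Analysis.Cauchy_Integral_Formula"
begin

text \<open>
  Write \<open>D = \<Omega> \<times> annulus\<close>. Both envelopes are the largest plurisubharmonic minorant of \<open>\<Psi>\<close> on \<open>D\<close>.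
  If \<open>v\<close> belongs to the class \<open>W\<close>, then for each \<open>z\<close> the function \<open>v (z, \<zeta>)\<close> is subharmonic in \<open>\<zeta>\<close>, its boundary
  values on the two circles are at most \<open>u0 z\<close> and \<open>u1 z\<close>, and \<open>\<Psi> (z, \<zeta>)\<close> is the harmonic function with these
  boundary values; so \<open>v \<le> \<Psi>\<close> by the maximum principle (\<open>W_le_\<Psi>\<close>). Conversely, the regularized supremum \<open>w\<close>
  of all plurisubharmonic minorants of \<open>\<Psi>\<close> is plurisubharmonic, and it stays below \<open>\<Psi>\<close> since \<open>\<Psi>\<close> is upper
  semicontinuous (\<open>psh_envelope_properties\<close>). From \<open>w \<le> \<Psi>\<close> one reads off the boundary condition, so
  \<open>w\<close> belongs to \<open>W\<close>. This is the first part (\<open>upper_envelope_properties\<close>).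

  For the second part, near every boundary point of \<open>D\<close> there is a continuous plurisubharmonic minorant of
  \<open>\<Psi>\<close> that is almost equal to \<open>\<Psi>\<close> there: \<open>u0 - C ln |\<zeta>|\<close> and its mirror image near the two circles, and
  \<open>\<Psi> (z0, \<zeta>) - e + C \<rho> z\<close> with a barrier \<open>\<rho>\<close> over a frontier point \<open>z0\<close> of \<open>\<Omega>\<close> (\<open>boundary_minorant\<close>). Hence \<open>w\<close>
  attains the boundary values \<open>\<Psi>\<close> uniformly. Walsh's translation argument (\<open>walsh_translation\<close>) transports
  this to a modulus of continuity in the interior: a slightly lowered translate of \<open>w\<close> can be glued to \<open>w\<close>
  and is then a competitor in the definition of \<open>w\<close>.

  The glued function satisfies the sub-mean value inequality a priori on small circles only, whereas the
  definition of plurisubharmonicity asks for it on every disc. The passage from small circles to all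
  discs (\<open>psh_onI_local\<close>) rests on the maximum principle and on the uniform approximation of continuous
  functions on the circle by real parts of polynomials. Throughout, sub-mean value inequalities are tested
  against continuous majorants; one limit argument (\<open>le_circle_avg_of_majorants\<close>) returns from there to the
  means of the upper semicontinuous functions themselves.
\<close>

section \<open>Averages over the unit circle\<close>

definition circle_avg :: "(complex \<Rightarrow> real) \<Rightarrow> real" where
  "circle_avg g = (LINT t:{0..1}|lborel. g (cis (2 * pi * t)))"

lemma continuous_on_circle_parametrization:
  assumes "continuous_on (sphere 0 1) g"
  shows "continuous_on {0..1} (\<lambda>t. g (cis (2 * pi * t)))"
  by (rule continuous_on_compose2[OF assms]) (auto intro!: continuous_intros)

lemma set_integrable_circle:
  fixes g :: "complex \<Rightarrow> real"
  assumes "continuous_on (sphere 0 1) g"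
  shows "set_integrable lborel {0..1} (\<lambda>t. g (cis (2 * pi * t)))"
  by (intro borel_integrable_atLeastAtMost' continuous_on_circle_parametrization assms)

lemma circle_avg_add:
  assumes "continuous_on (sphere 0 1) f" "continuous_on (sphere 0 1) g"
  shows "circle_avg (\<lambda>l. f l + g l) = circle_avg f + circle_avg g"
  unfolding circle_avg_def by (intro set_integral_add set_integrable_circle assms)

lemma circle_avg_cmult: "circle_avg (\<lambda>l. c * f l) = c * circle_avg f"
  unfolding circle_avg_def by simp

lemma circle_avg_const [simp]: "circle_avg (\<lambda>l. c) = c"
  unfolding circle_avg_def set_lebesgue_integral_def by simp

lemma circle_avg_mono:
  assumes "continuous_on (sphere 0 1) f" "continuous_on (sphere 0 1) g"
    and "\<And>l. l \<in> sphere 0 1 \<Longrightarrow> f l \<le> g l"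
  shows "circle_avg f \<le> circle_avg g"
  unfolding circle_avg_def by (intro set_integral_mono set_integrable_circle assms) auto

lemma circle_avg_cong:
  assumes "\<And>l. l \<in> sphere 0 1 \<Longrightarrow> f l = g l"
  shows "circle_avg f = circle_avg g"
  unfolding circle_avg_def by (intro set_lebesgue_integral_cong) (auto intro: assms)

text \<open>
  The mean value property of harmonic functions, in the form given by Cauchy's formula at the centre.
\<close>
lemma circle_avg_Re_holomorphic:
  assumes "continuous_on (cball 0 1) F" "F holomorphic_on ball 0 1"
  shows "circle_avg (\<lambda>l. Re (F l)) = Re (F 0)"
proof -
  have "((\<lambda>u. F u / u) has_contour_integral (2 * of_real pi * \<i> * F 0)) (circlepath 0 1)"
    using Cauchy_integral_circlepath[OF assms, of 0] by simp
  then have "((\<lambda>t. F (circlepath 0 1 t) / circlepath 0 1 t * vector_derivative (circlepath 0 1) (at t))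
      has_integral (2 * of_real pi * \<i> * F 0)) {0..1}"
    by (simp add: has_contour_integral)
  moreover have "circlepath 0 1 t = cis (2 * pi * t)" for t
    by (simp add: circlepath cis_conv_exp algebra_simps)
  moreover have "vector_derivative (circlepath 0 1) (at t) = 2 * of_real pi * \<i> * cis (2 * pi * t)" for t
    by (simp add: vector_derivative_circlepath cis_conv_exp algebra_simps)
  ultimately have "((\<lambda>t. 2 * of_real pi * \<i> * F (cis (2 * pi * t))) has_integral (2 * of_real pi * \<i> * F 0)) {0..1}"
    by (simp add: mult_ac)
  then have "((\<lambda>t. F (cis (2 * pi * t))) has_integral F 0) {0..1}"
    by (simp add: has_integral_mult_right_iff)
  then have "((\<lambda>t. Re (F (cis (2 * pi * t)))) has_integral Re (F 0)) {0..1}"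
    using has_integral_Re by blast
  moreover have "set_integrable lborel {0..1} (\<lambda>t. Re (F (cis (2 * pi * t))))"
    using assms(1) by (intro set_integrable_circle continuous_intros) (auto elim: continuous_on_subset)
  ultimately show ?thesis
    unfolding circle_avg_def by (simp add: set_borel_integral_eq_integral integral_unique)
qed

text \<open>
  If the disc avoids the origin, then \<open>|b| < |a|\<close>, hence \<open>1 + l b / a\<close> stays in the right half plane,
  where the principal branch of the logarithm is holomorphic: \<open>ln |a + l b|\<close> is the real part of a
  holomorphic function of \<open>l\<close>. This is why \<open>\<Psi>\<close> is harmonic in the second variable.
\<close>
lemma circle_avg_ln_norm:
  assumes "\<And>l. norm l \<le> 1 \<Longrightarrow> a + l * b \<noteq> 0"
  shows "circle_avg (\<lambda>l. ln (norm (a + l * b))) = ln (norm a)"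
proof -
  have a: "a \<noteq> 0" using assms[of 0] by simp
  have ba: "norm (b / a) < 1"
  proof (rule ccontr)
    assume "\<not> norm (b / a) < 1"
    then have b: "b \<noteq> 0" "norm a \<le> norm b" using a by (auto simp: norm_divide divide_less_eq)
    then have "norm (- a / b) \<le> 1" by (simp add: norm_divide divide_le_eq)
    then show False using assms[of "- a / b"] b by simp
  qed
  define q where "q = b / a"
  have Re_pos: "Re (1 + l * q) > 0" if "norm l \<le> 1" for l
  proof -
    have "norm (l * q) = norm l * norm q" by (rule norm_mult)
    also have "\<dots> \<le> 1 * norm q" using that by (intro mult_right_mono) auto
    finally have "norm (l * q) < 1" using ba by (simp add: q_def)
    then show ?thesis using abs_Re_le_cmod[of "l * q"] by simp
  qed
  then have nonpos: "1 + l * q \<notin> \<real>\<^sub>\<le>\<^sub>0" if "norm l \<le> 1" for l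
    using Re_pos[OF that] by (auto simp: complex_nonpos_Reals_iff)
  have "circle_avg (\<lambda>l. Re (Ln (1 + l * q))) = Re (Ln (1 + 0 * q))"
    using nonpos by (intro circle_avg_Re_holomorphic continuous_intros holomorphic_intros) auto
  then have 0: "circle_avg (\<lambda>l. Re (Ln (1 + l * q))) = 0" by simp
  have c: "continuous_on (sphere 0 1) (\<lambda>l. Re (Ln (1 + l * q)))"
    using nonpos by (intro continuous_intros) auto
  have "circle_avg (\<lambda>l. ln (norm (a + l * b))) = circle_avg (\<lambda>l. ln (norm a) + Re (Ln (1 + l * q)))"
  proof (rule circle_avg_cong)
    fix l :: complex assume l: "l \<in> sphere 0 1"
    then have "1 + l * q \<noteq> 0" using Re_pos[of l] by (auto simp del: plus_complex.sel times_complex.sel)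
    moreover have "a + l * b = a * (1 + l * q)" using a by (simp add: q_def field_simps)
    ultimately show "ln (norm (a + l * b)) = ln (norm a) + Re (Ln (1 + l * q))"
      using a by (simp add: norm_mult ln_mult)
  qed
  then show ?thesis using 0 c by (simp add: circle_avg_add)
qed

lemma circle_mean_mono:
  assumes "\<And>l. l \<in> sphere 0 1 \<Longrightarrow> f l \<le> g l"
  shows "circle_mean f \<le> circle_mean g"
  unfolding circle_mean_def
proof (intro ereal_minus_mono)
  show "enn2ereal (\<integral>\<^sup>+t\<in>{0..1}. e2ennreal (f (cis (2 * pi * t))) \<partial>lborel)
      \<le> enn2ereal (\<integral>\<^sup>+t\<in>{0..1}. e2ennreal (g (cis (2 * pi * t))) \<partial>lborel)"
    by (intro less_eq_ennreal.rep_eq[THEN iffD1] nn_integral_mono mult_right_mono e2ennreal_mono assms) auto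
  show "enn2ereal (\<integral>\<^sup>+t\<in>{0..1}. e2ennreal (- g (cis (2 * pi * t))) \<partial>lborel)
      \<le> enn2ereal (\<integral>\<^sup>+t\<in>{0..1}. e2ennreal (- f (cis (2 * pi * t))) \<partial>lborel)"
    by (intro less_eq_ennreal.rep_eq[THEN iffD1] nn_integral_mono mult_right_mono e2ennreal_mono) (auto simp: assms)
qed

lemma circle_mean_ereal:
  assumes "set_integrable lborel {0..1} (\<lambda>t. g (cis (2 * pi * t)))"
  shows "circle_mean (\<lambda>l. ereal (g l)) = ereal (circle_avg g)"
proof -
  define h where "h t = indicator {0..1::real} t * g (cis (2 * pi * t))" for t
  have int: "integrable lborel h" using assms by (simp add: set_integrable_def h_def[abs_def])
  have pos: "(\<integral>\<^sup>+t\<in>{0..1}. e2ennreal (ereal (g (cis (2 * pi * t)))) \<partial>lborel) = (\<integral>\<^sup>+t. ennreal (h t) \<partial>lborel)"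
    by (intro nn_integral_cong) (simp add: h_def indicator_def)
  have neg: "(\<integral>\<^sup>+t\<in>{0..1}. e2ennreal (- ereal (g (cis (2 * pi * t)))) \<partial>lborel) = (\<integral>\<^sup>+t. ennreal (- h t) \<partial>lborel)"
    by (intro nn_integral_cong) (simp add: h_def indicator_def)
  have fin: "(\<integral>\<^sup>+t. ennreal (h t) \<partial>lborel) \<noteq> \<infinity>" "(\<integral>\<^sup>+t. ennreal (- h t) \<partial>lborel) \<noteq> \<infinity>"
    using int by (auto simp: real_integrable_def)
  have enn: "enn2ereal x = ereal (enn2real x)" if "x \<noteq> \<infinity>" for x
    using that by (cases x) auto
  have "circle_avg g = enn2real (\<integral>\<^sup>+t. ennreal (h t) \<partial>lborel) - enn2real (\<integral>\<^sup>+t. ennreal (- h t) \<partial>lborel)"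
    using real_lebesgue_integral_def[OF int] by (simp add: circle_avg_def set_lebesgue_integral_def h_def[abs_def])
  then show ?thesis
    unfolding circle_mean_def pos neg using fin by (simp add: enn)
qed

text \<open>
  For functions with values in \<open>[-\<infinity>, \<infinity>)\<close> the mean over a circle is awkward to compute with.
  Testing the sub-mean value inequality against continuous real majorants on the circle avoids this,
  because it needs nothing but the monotonicity of \<open>circle_mean\<close>. Most arguments below use
  plurisubharmonicity in this form.
\<close>
lemma psh_on_le_circle_avg:
  assumes "psh_on sc G v" "\<And>l. norm l \<le> 1 \<Longrightarrow> a + sc l b \<in> G"
    and "continuous_on (sphere 0 1) g"
    and "\<And>l. l \<in> sphere 0 1 \<Longrightarrow> v (a + sc l b) \<le> ereal (g l)"
  shows "v a \<le> ereal (circle_avg g)"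
proof -
  have "v a \<le> circle_mean (\<lambda>l. v (a + sc l b))" using assms(1,2) by (auto simp: psh_on_def)
  also have "\<dots> \<le> circle_mean (\<lambda>l. ereal (g l))" by (intro circle_mean_mono assms(4))
  finally show ?thesis by (simp add: circle_mean_ereal set_integrable_circle assms(3))
qed

section \<open>Upper semicontinuous functions\<close>

lemma usc_onD:
  assumes "usc_on G f" and x: "x \<in> G" "f x < c"
  shows "\<exists>U. open U \<and> x \<in> U \<and> (\<forall>y\<in>U \<inter> G. f y < c)"
proof -
  have "openin (top_of_set G) {x \<in> G. f x < c}" using assms(1) by (simp add: usc_on_def)
  then obtain U where U: "open U" "{x \<in> G. f x < c} = G \<inter> U"
    by (metis openin_open)
  then show "\<exists>U. open U \<and> x \<in> U \<and> (\<forall>y\<in>U \<inter> G. f y < c)"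
    using x by (intro exI[of _ U]) auto
qed

lemma usc_onI:
  assumes R: "\<And>x c. x \<in> G \<Longrightarrow> f x < c \<Longrightarrow> \<exists>U. open U \<and> x \<in> U \<and> (\<forall>y\<in>U \<inter> G. f y < c)"
  shows "usc_on G f"
  unfolding usc_on_def
proof
  fix c
  have "\<exists>T. openin (top_of_set G) T \<and> x \<in> T \<and> T \<subseteq> {x \<in> G. f x < c}" if "x \<in> {x \<in> G. f x < c}" for x
  proof -
    from that R obtain U where "open U" "x \<in> U" "\<forall>y\<in>U \<inter> G. f y < c" by blast
    then show ?thesis using that by (intro exI[of _ "G \<inter> U"]) (auto simp: openin_open_Int)
  qed
  then show "openin (top_of_set G) {x \<in> G. f x < c}"
    using openin_subopen by (metis (no_types, lifting))
qed

lemma usc_on_add_continuous: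
  assumes "usc_on K f" "continuous_on K h"
  shows "usc_on K (\<lambda>x. f x + ereal (h x))"
proof (rule usc_onI)
  fix x c assume x: "x \<in> K" and c: "f x + ereal (h x) < c"
  then have "f x < c - ereal (h x)" by (simp add: ereal_less_minus_iff)
  then obtain d where d: "f x < ereal d" "ereal d < c - ereal (h x)" using ereal_dense2 by blast
  then have "ereal (h x) < c - ereal d"
    by (cases c) auto
  then obtain e where e: "ereal (h x) < ereal e" "ereal e < c - ereal d" using ereal_dense2 by blast
  obtain U where U: "open U" "x \<in> U" "\<forall>y\<in>U \<inter> K. f y < ereal d"
    using usc_onD[OF assms(1) x d(1)] by blast
  obtain V where V: "open V" "x \<in> V" "\<forall>y\<in>V \<inter> K. h y < e"
    using continuous_on_open_invariant[THEN iffD1, OF assms(2), rule_format, of "{..<e}"] x e(1)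
    by auto
  have "f y + ereal (h y) < c" if "y \<in> (U \<inter> V) \<inter> K" for y
  proof -
    have "f y < ereal d" "h y < e" using U V that by auto
    then have "f y + ereal (h y) \<le> ereal d + ereal e" by (intro add_mono) auto
    also have "\<dots> < c" using e(2) by (cases c) auto
    finally show ?thesis .
  qed
  then show "\<exists>U. open U \<and> x \<in> U \<and> (\<forall>y\<in>U \<inter> K. f y + ereal (h y) < c)"
    using U V by (intro exI[of _ "U \<inter> V"]) auto
qed

lemma usc_on_compose:
  assumes "usc_on G f" "continuous_on K \<gamma>" "\<gamma> ` K \<subseteq> G"
  shows "usc_on K (\<lambda>x. f (\<gamma> x))"
proof (rule usc_onI)
  fix x c assume x: "x \<in> K" and c: "f (\<gamma> x) < c"
  have "\<gamma> x \<in> G" using assms(3) x by blast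
  from usc_onD[OF assms(1) this c]
  obtain U where U: "open U" "\<gamma> x \<in> U" "\<forall>y\<in>U \<inter> G. f y < c" by blast
  obtain V where V: "open V" "V \<inter> K = \<gamma> -` U \<inter> K"
    using continuous_on_open_invariant[THEN iffD1, OF assms(2), rule_format, OF U(1)] by metis
  have V': "y \<in> V \<longleftrightarrow> \<gamma> y \<in> U" if "y \<in> K" for y
    using set_eq_iff[THEN iffD1, OF V(2), rule_format, of y] that by simp
  have "x \<in> V" using V' U(2) x by simp
  moreover have "f (\<gamma> y) < c" if "y \<in> V \<inter> K" for y
    using U(3) V'[of y] that assms(3) by (simp add: image_subset_iff)
  ultimately show "\<exists>U. open U \<and> x \<in> U \<and> (\<forall>y\<in>U \<inter> K. f (\<gamma> y) < c)"
    using V(1) by (intro exI[of _ V]) simp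
qed

lemma continuous_imp_usc_on:
  assumes "continuous_on K h"
  shows "usc_on K (\<lambda>x. ereal (h x))"
proof -
  have "usc_on K (\<lambda>x. 0 :: ereal)" by (intro usc_onI exI[of _ UNIV]) auto
  from usc_on_add_continuous[OF this assms] show ?thesis by simp
qed

lemma usc_on_attains_sup:
  assumes "compact K" "K \<noteq> {}" "usc_on K f"
  obtains x where "x \<in> K" "\<And>y. y \<in> K \<Longrightarrow> f y \<le> f x"
proof (rule ccontr)
  assume "\<not> thesis"
  then have "\<forall>x\<in>K. \<exists>y\<in>K. f x < f y" using that by (meson not_le)
  then obtain \<sigma> where \<sigma>: "\<And>x. x \<in> K \<Longrightarrow> \<sigma> x \<in> K" "\<And>x. x \<in> K \<Longrightarrow> f x < f (\<sigma> x)" by metis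
  have "\<forall>x\<in>K. \<exists>U. open U \<and> x \<in> U \<and> (\<forall>y\<in>U \<inter> K. f y < f (\<sigma> x))"
    using usc_onD[OF assms(3)] \<sigma>(2) by blast
  then obtain U where U: "\<And>x. x \<in> K \<Longrightarrow> open (U x)" "\<And>x. x \<in> K \<Longrightarrow> x \<in> U x"
      "\<And>x. x \<in> K \<Longrightarrow> \<forall>y\<in>U x \<inter> K. f y < f (\<sigma> x)" by (auto dest!: bchoice)
  have "K \<subseteq> (\<Union>x\<in>K. U x)" using U(2) by blast
  then obtain C where C: "C \<subseteq> K" "finite C" "K \<subseteq> (\<Union>x\<in>C. U x)"
    by (rule compactE_image[OF assms(1) U(1), rotated]) auto
  have "C \<noteq> {}" using C assms(2) by auto
  then obtain x where x': "x \<in> C" "f (\<sigma> x) = Max ((\<lambda>x. f (\<sigma> x)) ` C)"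
    using obtains_MAX[OF C(2), of "\<lambda>x. f (\<sigma> x)"] by metis
  then have x: "x \<in> C" "f (\<sigma> y) \<le> f (\<sigma> x)" if "y \<in> C" for y
    using C(2) that by auto
  obtain y where y: "y \<in> C" "\<sigma> x \<in> U y" using C x' \<sigma>(1) by blast
  have "y \<in> K" "\<sigma> x \<in> K" using x' y C \<sigma>(1) by auto
  then have "f (\<sigma> x) < f (\<sigma> y)" using U(3)[of y] y by auto
  then show False using x(2)[OF y(1)] by simp
qed

section \<open>The maximum principle\<close>

text \<open>
  Adding the small strictly subharmonic term \<open>\<eta> |z|\<^sup>2\<close> makes the sub-mean value inequality strict at a
  maximum point \<open>m\<close>, which is a contradiction. At such a point the function is bounded on the circle by
  the continuous function \<open>f m + \<eta> |m|\<^sup>2 - \<eta> |z|\<^sup>2\<close>, so that submeanness with respect to continuous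
  majorants is all that is needed. The radius of the circle may depend on its centre.
\<close>
lemma maximum_principle:
  fixes f :: "complex \<Rightarrow> ereal"
  assumes "compact K" "usc_on K f" "\<And>z. z \<in> K \<Longrightarrow> f z < \<infinity>"
    and submean: "\<And>z. z \<in> K \<Longrightarrow> 0 < f z \<Longrightarrow> \<exists>r>0. (\<forall>l\<in>sphere 0 1. z + of_real r * l \<in> K) \<and>
      (\<forall>g. continuous_on (sphere 0 1) g \<longrightarrow> (\<forall>l\<in>sphere 0 1. f (z + of_real r * l) \<le> ereal (g l))
          \<longrightarrow> f z \<le> ereal (circle_avg g))"
    and "z \<in> K"
  shows "f z \<le> 0"
proof (rule ccontr)
  assume "\<not> f z \<le> 0"
  then have fz: "0 < f z" by simp
  obtain B where B: "B > 0" "\<And>x. x \<in> K \<Longrightarrow> norm x \<le> B"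
    using compact_imp_bounded[OF assms(1)] unfolding bounded_pos by blast
  obtain s where s: "0 < s" "ereal s < f z" using ereal_dense2[OF fz] by (metis ereal_less(2))
  define \<eta> where "\<eta> = s / B\<^sup>2"
  have \<eta>: "\<eta> > 0" "\<eta> * (norm x)\<^sup>2 \<le> s" if "x \<in> K" for x
    using B s that by (auto simp: \<eta>_def field_simps intro!: power_mono)
  have "usc_on K (\<lambda>x. f x + ereal (\<eta> * (norm x)\<^sup>2))"
    by (intro usc_on_add_continuous assms continuous_intros)
  then obtain m where m: "m \<in> K" "\<And>y. y \<in> K \<Longrightarrow> f y + ereal (\<eta> * (norm y)\<^sup>2) \<le> f m + ereal (\<eta> * (norm m)\<^sup>2)"
    using usc_on_attains_sup[OF assms(1)] assms(5) by blast
  have "f z \<le> f z + ereal (\<eta> * (norm z)\<^sup>2)" using \<eta>(1)[OF assms(5)] by (intro ereal_le_add_self) auto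
  also have "\<dots> \<le> f m + ereal (\<eta> * (norm m)\<^sup>2)" using m assms(5) by blast
  also have "\<dots> \<le> f m + ereal s" using \<eta>(2)[OF m(1)] by (intro add_left_mono) auto
  finally have "ereal s < f m + ereal s" using s by order
  then have fm: "0 < f m" by (cases "f m") auto
  then obtain \<mu> where \<mu>: "f m = ereal \<mu>" using assms(3)[OF m(1)] by (cases "f m") auto
  obtain r where r: "r > 0" "\<And>l. l \<in> sphere 0 1 \<Longrightarrow> m + of_real r * l \<in> K"
     "\<And>g. continuous_on (sphere 0 1) g \<Longrightarrow> (\<And>l. l \<in> sphere 0 1 \<Longrightarrow> f (m + of_real r * l) \<le> ereal (g l))
          \<Longrightarrow> f m \<le> ereal (circle_avg g)"
    using submean[OF m(1) fm] by blast
  \<comment> \<open>On the circle \<open>|l| = 1\<close>, \<open>F\<close> has the real part \<open>\<mu> + \<eta> |m|\<^sup>2 - \<eta> |m + r l|\<^sup>2\<close>.\<close>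
  define F where "F l = complex_of_real (\<mu> - \<eta> * r\<^sup>2) - of_real (2 * \<eta> * r) * (cnj m * l)" for l
  have "f m \<le> ereal (circle_avg (\<lambda>l. Re (F l)))"
  proof (rule r(3))
    show "continuous_on (sphere 0 1) (\<lambda>l. Re (F l))" unfolding F_def by (intro continuous_intros)
    fix l :: complex assume l: "l \<in> sphere 0 1"
    have "(norm (m + of_real r * l))\<^sup>2 = (norm m)\<^sup>2 + r\<^sup>2 * (norm l)\<^sup>2 + 2 * r * Re (cnj m * l)"
      unfolding cmod_power2 by (simp add: power2_eq_square algebra_simps)
    then have "(norm (m + of_real r * l))\<^sup>2 = (norm m)\<^sup>2 + r\<^sup>2 + 2 * r * Re (cnj m * l)" using l by simp
    then have F: "Re (F l) = \<mu> + \<eta> * (norm m)\<^sup>2 - \<eta> * (norm (m + of_real r * l))\<^sup>2"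
      by (simp add: F_def algebra_simps)
    show "f (m + of_real r * l) \<le> ereal (Re (F l))"
      unfolding F using m(2)[OF r(2)[OF l]] \<mu> by (cases "f (m + of_real r * l)") auto
  qed
  also have "circle_avg (\<lambda>l. Re (F l)) = Re (F 0)"
    unfolding F_def by (intro circle_avg_Re_holomorphic continuous_intros holomorphic_intros)
  finally have "\<mu> \<le> \<mu> - \<eta> * r\<^sup>2" by (simp add: F_def \<mu>)
  then show False using \<eta>(1)[OF m(1)] r(1) by (simp add: mult_le_0_iff)
qed

section \<open>Plurisubharmonicity tested against majorants\<close>

text \<open>
  The majorants are the sup-convolutions \<open>\<lambda>x. SUP y\<in>G. f y - n * dist x y\<close>. They are \<open>n\<close>-Lipschitz, and upper
  semicontinuity makes them decrease to \<open>f\<close>: points \<open>y\<close> far from \<open>x\<close> do not contribute once \<open>n\<close> is large.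
\<close>
lemma usc_lipschitz_majorants:
  fixes f :: "'a::metric_space \<Rightarrow> real"
  assumes "usc_on G (\<lambda>x. ereal (f x))" "G \<noteq> {}" "\<And>x. x \<in> G \<Longrightarrow> \<bar>f x\<bar> \<le> M"
  obtains g :: "nat \<Rightarrow> 'a \<Rightarrow> real" where
    "\<And>n. (real n)-lipschitz_on UNIV (g n)" "\<And>n x. x \<in> G \<Longrightarrow> f x \<le> g n x"
    "\<And>n x. x \<in> G \<Longrightarrow> g n x \<le> M" "\<And>x. x \<in> G \<Longrightarrow> (\<lambda>n. g n x) \<longlonglongrightarrow> f x"
proof
  define g where "g n x = (SUP y\<in>G. f y - real n * dist x y)" for n x
  have fM: "f y \<le> M" "- M \<le> f y" if "y \<in> G" for y using assms(3)[OF that] by auto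
  have bdd: "bdd_above ((\<lambda>y. f y - real n * dist x y) ` G)" for n x
  proof (rule bdd_aboveI2)
    fix y assume "y \<in> G"
    then have "f y \<le> M" by (rule fM)
    moreover have "0 \<le> real n * dist x y" by simp
    ultimately show "f y - real n * dist x y \<le> M" by linarith
  qed
  have shift: "g n x \<le> g n x' + real n * dist x x'" for n x x'
    unfolding g_def
  proof (rule cSUP_least[OF assms(2)])
    fix y assume y: "y \<in> G"
    have "f y - real n * dist x' y \<le> (SUP y\<in>G. f y - real n * dist x' y)"
      by (rule cSUP_upper[OF y bdd])
    moreover have "real n * dist x' y \<le> real n * (dist x x' + dist x y)"
      by (intro mult_left_mono) (auto simp: dist_triangle3)
    ultimately show "f y - real n * dist x y \<le> (SUP y\<in>G. f y - real n * dist x' y) + real n * dist x x'"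
      by (simp add: distrib_left)
  qed
  show "(real n)-lipschitz_on UNIV (g n)" for n
  proof (rule lipschitz_onI)
    fix x y show "dist (g n x) (g n y) \<le> real n * dist x y"
      using shift[of n x y] shift[of n y x] by (simp add: dist_real_def dist_commute abs_le_iff)
  qed simp
  show fg: "f x \<le> g n x" if "x \<in> G" for n x
    using cSUP_upper[OF that bdd, of n x] by (simp add: g_def)
  show "g n x \<le> M" if "x \<in> G" for n x
    unfolding g_def
  proof (rule cSUP_least[OF assms(2)])
    fix y assume "y \<in> G"
    then have "f y \<le> M" by (rule fM)
    moreover have "0 \<le> real n * dist x y" by simp
    ultimately show "f y - real n * dist x y \<le> M" by linarith
  qed
  show "(\<lambda>n. g n x) \<longlonglongrightarrow> f x" if x: "x \<in> G" for x
  proof (rule tendstoI)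
    fix e :: real assume e: "e > 0"
    then have "ereal (f x) < ereal (f x + e / 2)" by simp
    from usc_onD[OF assms(1) x this] obtain U
      where U: "open U" "x \<in> U" "\<forall>y\<in>U \<inter> G. ereal (f y) < ereal (f x + e / 2)" by blast
    then obtain d where d: "d > 0" "ball x d \<subseteq> U" using open_contains_ball by blast
    obtain N :: nat where N: "2 * M / d \<le> real N" using real_arch_simple by blast
    have "dist (g n x) (f x) < e" if n: "n \<ge> N" for n
    proof -
      have "g n x \<le> f x + e / 2"
        unfolding g_def
      proof (rule cSUP_least[OF assms(2)])
        fix y assume y: "y \<in> G"
        show "f y - real n * dist x y \<le> f x + e / 2"
        proof (cases "dist x y < d")
          case True
          then have "y \<in> U \<inter> G" using d y by auto
          then have "f y < f x + e / 2" using U(3) by (metis less_ereal.simps(1))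
          moreover have "0 \<le> real n * dist x y" by simp
          ultimately show ?thesis by linarith
        next
          case False
          have "2 * M \<le> real N * d" using N d by (simp add: field_simps)
          also have "\<dots> \<le> real n * dist x y" using n False d by (intro mult_mono) auto
          finally show ?thesis using fM[OF y] fM[OF x] e by linarith
        qed
      qed
      then show ?thesis using fg[OF x, of n] e by (simp add: dist_real_def)
    qed
    then show "\<forall>\<^sub>F n in sequentially. dist (g n x) (f x) < e"
      unfolding eventually_sequentially by blast
  qed
qed

text \<open>
  Dominated convergence along the Lipschitz majorants that decrease to \<open>f\<close>; as a pointwise limit of
  continuous functions, \<open>f\<close> is measurable along the circle.
\<close>
lemma le_circle_avg_of_majorants:
  fixes f :: "'a::metric_space \<Rightarrow> real" and \<gamma> :: "complex \<Rightarrow> 'a"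
  assumes "usc_on G (\<lambda>x. ereal (f x))" "\<And>x. x \<in> G \<Longrightarrow> \<bar>f x\<bar> \<le> M"
    and \<gamma>: "continuous_on (sphere 0 1) \<gamma>" "\<gamma> ` sphere 0 1 \<subseteq> G"
    and maj: "\<And>L g. L-lipschitz_on UNIV g \<Longrightarrow> (\<And>x. x \<in> G \<Longrightarrow> f x \<le> g x) \<Longrightarrow> c \<le> circle_avg (\<lambda>l. g (\<gamma> l))"
  shows "ereal c \<le> circle_mean (\<lambda>l. ereal (f (\<gamma> l)))"
proof -
  have "\<gamma> 1 \<in> G" using \<gamma>(2) by auto
  then have "G \<noteq> {}" by auto
  obtain g :: "nat \<Rightarrow> 'a \<Rightarrow> real" where
    g: "\<And>n. (real n)-lipschitz_on UNIV (g n)" "\<And>n x. x \<in> G \<Longrightarrow> f x \<le> g n x"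
    "\<And>n x. x \<in> G \<Longrightarrow> g n x \<le> M" "\<And>x. x \<in> G \<Longrightarrow> (\<lambda>n. g n x) \<longlonglongrightarrow> f x"
    by (rule usc_lipschitz_majorants[OF assms(1) \<open>G \<noteq> {}\<close> assms(2)]) auto
  have cont: "continuous_on (sphere 0 1) (\<lambda>l. g n (\<gamma> l))" for n
    using lipschitz_on_continuous_on[OF g(1)] \<gamma>(1) by (rule continuous_on_compose2) auto
  define s where "s n t = indicator {0..1} t *\<^sub>R g n (\<gamma> (cis (2 * pi * t)))" for n and t :: real
  define s' where "s' t = indicator {0..1} t *\<^sub>R f (\<gamma> (cis (2 * pi * t)))" for t :: real
  have \<gamma>G: "\<gamma> (cis t) \<in> G" for t using \<gamma>(2) by auto
  have int: "integrable lborel (s n)" for n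
    using set_integrable_circle[OF cont, of n] by (simp add: set_integrable_def s_def[abs_def])
  have lim: "(\<lambda>n. s n t) \<longlonglongrightarrow> s' t" for t
    unfolding s_def s'_def by (intro tendsto_intros g(4) \<gamma>G)
  have meas: "s n \<in> borel_measurable lborel" for n using int[of n] by auto
  have meas': "s' \<in> borel_measurable lborel"
    by (rule borel_measurable_LIMSEQ_real[of lborel s]) (use lim meas in auto)
  have bound: "norm (s n t) \<le> indicator {0..1} t * M" for n t
  proof -
    have "\<bar>g n (\<gamma> (cis (2 * pi * t)))\<bar> \<le> M"
      using g(2)[OF \<gamma>G, of "2 * pi * t" n] g(3)[OF \<gamma>G, of n "2 * pi * t"] assms(2)[OF \<gamma>G, of "2 * pi * t"]
      by linarith
    then show ?thesis by (auto simp: s_def indicator_def)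
  qed
  have intM: "integrable lborel (\<lambda>t. indicator {0..1::real} t * M)"
    by (intro integrable_mult_left integrable_real_indicator) auto
  note dom = intM AE_I2[OF lim] AE_I2[OF bound]
  have "integrable lborel s'"
    by (rule integrable_dominated_convergence[OF meas' meas dom])
  then have si: "set_integrable lborel {0..1} (\<lambda>t. f (\<gamma> (cis (2 * pi * t))))"
    by (simp add: set_integrable_def s'_def[abs_def])
  have "(\<lambda>n. integral\<^sup>L lborel (s n)) \<longlonglongrightarrow> integral\<^sup>L lborel s'"
    by (rule integral_dominated_convergence[OF meas' meas dom])
  moreover have "c \<le> integral\<^sup>L lborel (s n)" for n
    using maj[OF g(1), of n] g(2) by (simp add: circle_avg_def set_lebesgue_integral_def s_def[abs_def])
  ultimately have "c \<le> integral\<^sup>L lborel s'" by (intro LIMSEQ_le_const) auto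
  then have "c \<le> circle_avg (\<lambda>l. f (\<gamma> l))"
    by (simp add: circle_avg_def set_lebesgue_integral_def s'_def[abs_def])
  then show ?thesis using si by (simp add: circle_mean_ereal)
qed

text \<open>
  The converse of \<open>psh_on_le_circle_avg\<close>: for bounded real functions the sub-mean value inequality
  needs to be checked for Lipschitz majorants only.
\<close>
lemma psh_onI_majorants:
  fixes f :: "'a::real_normed_vector \<Rightarrow> real"
  assumes "usc_on G (\<lambda>x. ereal (f x))" "\<And>x. x \<in> G \<Longrightarrow> \<bar>f x\<bar> \<le> M"
    and sc: "\<And>b. continuous_on UNIV (\<lambda>l. sc l b)"
    and maj: "\<And>a b L g. (\<And>l. norm l \<le> 1 \<Longrightarrow> a + sc l b \<in> G) \<Longrightarrow> L-lipschitz_on UNIV g \<Longrightarrow>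
      (\<And>x. x \<in> G \<Longrightarrow> f x \<le> g x) \<Longrightarrow> f a \<le> circle_avg (\<lambda>l. g (a + sc l b))"
  shows "psh_on sc G (\<lambda>x. ereal (f x))"
  unfolding psh_on_def
proof (intro conjI allI impI ballI)
  fix a b assume disc: "\<forall>l. norm l \<le> 1 \<longrightarrow> a + sc l b \<in> G"
  show "ereal (f a) \<le> circle_mean (\<lambda>l. ereal (f (a + sc l b)))"
  proof (rule le_circle_avg_of_majorants[OF assms(1,2)])
    show "continuous_on (sphere 0 1) (\<lambda>l. a + sc l b)"
      by (intro continuous_intros continuous_on_subset[OF sc]) auto
    show "(\<lambda>l. a + sc l b) ` sphere 0 1 \<subseteq> G" using disc by auto
    show "f a \<le> circle_avg (\<lambda>l. g (a + sc l b))"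
      if "L-lipschitz_on UNIV g" "\<And>x. x \<in> G \<Longrightarrow> f x \<le> g x" for L g
      using disc that by (intro maj) auto
  qed
qed (use assms in auto)

section \<open>Plurisubharmonicity as a local property\<close>

text \<open>
  The functions whose restriction to the unit circle is a trigonometric polynomial; each of them has a
  harmonic extension to the disc, the real part of a complex polynomial.
\<close>
definition circle_harmonic :: "(complex \<Rightarrow> real) \<Rightarrow> bool" where
  "circle_harmonic f \<longleftrightarrow> (\<exists>p. \<forall>z\<in>sphere 0 1. f z = Re (poly p z))"

lemma circle_harmonic_sum:
  assumes "\<And>i. i \<in> I \<Longrightarrow> circle_harmonic (f i)"
  shows "circle_harmonic (\<lambda>z. \<Sum>i\<in>I. f i z)"
proof -
  have "\<forall>i\<in>I. \<exists>p. \<forall>z\<in>sphere 0 1. f i z = Re (poly p z)"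
    using assms by (auto simp: circle_harmonic_def)
  then obtain p where "\<forall>i\<in>I. \<forall>z\<in>sphere 0 1. f i z = Re (poly (p i) z)" by (rule bchoice[THEN exE])
  then show ?thesis
    unfolding circle_harmonic_def by (intro exI[of _ "\<Sum>i\<in>I. p i"]) (simp add: poly_sum)
qed

text \<open>
  Products stay in the class because \<open>cnj z = 1 / z\<close> on the unit circle:
  \<open>Re x * Re y = Re (x y + x cnj y) / 2\<close>, and \<open>z ^ i * cnj (z ^ j) = z ^ (i - j)\<close> for \<open>j \<le> i\<close>.
\<close>
lemma circle_harmonic_mult_monom:
  "circle_harmonic (\<lambda>z. Re (a * z ^ i) * Re (b * z ^ j))"
proof -
  have wlog: "circle_harmonic (\<lambda>z. Re (a * z ^ i) * Re (b * z ^ j))" if "j \<le> i" for a b i j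
    unfolding circle_harmonic_def
  proof (intro exI ballI)
    fix z :: complex assume z: "z \<in> sphere 0 1"
    have "z ^ i * cnj (z ^ j) = z ^ (i - j) * (z ^ j * cnj (z ^ j))"
      using that by (metis mult.assoc le_add_diff_inverse2 power_add)
    also have "z ^ j * cnj (z ^ j) = 1"
      using z by (simp add: complex_norm_square[symmetric] norm_power del: complex_cnj_power)
    finally have *: "z ^ i * cnj (z ^ j) = z ^ (i - j)" by simp
    have "Re x * Re y = Re (x * y + x * cnj y) / 2" for x y :: complex by simp
    then have "Re (a * z ^ i) * Re (b * z ^ j)
        = Re (a * z ^ i * (b * z ^ j) + a * z ^ i * cnj (b * z ^ j)) / 2" .
    also have "a * z ^ i * cnj (b * z ^ j) = a * cnj b * (z ^ i * cnj (z ^ j))" by simp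
    also have "\<dots> = a * cnj b * z ^ (i - j)" by (simp only: *)
    finally have "Re (a * z ^ i) * Re (b * z ^ j) = Re (a * z ^ i * (b * z ^ j) + a * cnj b * z ^ (i - j)) / 2" .
    also have "\<dots> = Re ((a * z ^ i * (b * z ^ j) + a * cnj b * z ^ (i - j)) / 2)"
      by (rule Re_divide_numeral[symmetric])
    also have "(a * z ^ i * (b * z ^ j) + a * cnj b * z ^ (i - j)) / 2 =
        poly (monom (a * b / 2) (i + j) + monom (a * cnj b / 2) (i - j)) z"
      by (simp add: poly_monom power_add add_divide_distrib)
    finally show "Re (a * z ^ i) * Re (b * z ^ j) =
        Re (poly (monom (a * b / 2) (i + j) + monom (a * cnj b / 2) (i - j)) z)" .
  qed
  show ?thesis
  proof (cases "j \<le> i")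
    case False
    then show ?thesis using wlog[of i j b a] by (simp add: mult.commute)
  qed (rule wlog)
qed

lemma circle_harmonic_mult:
  assumes "circle_harmonic f" "circle_harmonic g"
  shows "circle_harmonic (\<lambda>z. f z * g z)"
proof -
  obtain p q where p: "\<forall>z\<in>sphere 0 1. f z = Re (poly p z)" and q: "\<forall>z\<in>sphere 0 1. g z = Re (poly q z)"
    using assms by (auto simp: circle_harmonic_def)
  have "circle_harmonic (\<lambda>z. \<Sum>i\<le>degree p. \<Sum>j\<le>degree q. Re (coeff p i * z ^ i) * Re (coeff q j * z ^ j))"
    by (intro circle_harmonic_sum circle_harmonic_mult_monom)
  moreover have "f z * g z = (\<Sum>i\<le>degree p. \<Sum>j\<le>degree q. Re (coeff p i * z ^ i) * Re (coeff q j * z ^ j))"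
    if "z \<in> sphere 0 1" for z
    using p q that by (simp only: poly_altdef Re_sum sum_product)
  ultimately show ?thesis unfolding circle_harmonic_def by simp
qed

lemma real_polynomial_function_circle_harmonic:
  assumes "real_polynomial_function (f :: complex \<Rightarrow> real)"
  shows "circle_harmonic f"
  using assms
proof (induction rule: real_polynomial_function.induct)
  case (linear f)
  interpret bounded_linear f by fact
  have "f z = Re (poly [:0, Complex (f 1) (- f \<i>):] z)" for z
  proof -
    have "f z = f (Re z *\<^sub>R 1 + Im z *\<^sub>R \<i>)" by (rule arg_cong[where f = f]) (simp add: complex_eq_iff)
    also have "\<dots> = Re z * f 1 + Im z * f \<i>" by (simp add: add scale)
    finally show ?thesis by (simp add: mult.commute)
  qed
  then show ?case unfolding circle_harmonic_def by blast
next
  case (const c)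
  show ?case unfolding circle_harmonic_def by (intro exI[of _ "[:of_real c:]"]) simp
next
  case (add f g)
  then obtain p q where "\<forall>z\<in>sphere 0 1. f z = Re (poly p z)" "\<forall>z\<in>sphere 0 1. g z = Re (poly q z)"
    by (auto simp: circle_harmonic_def)
  then show ?case unfolding circle_harmonic_def by (intro exI[of _ "p + q"]) simp
qed (rule circle_harmonic_mult)

text \<open>
  An approximate solution of the Dirichlet problem on the disc, which replaces the Poisson integral:
  by the Stone-Weierstrass theorem, continuous boundary data are uniformly close to the boundary values of
  the real part of a polynomial.
\<close>
lemma circle_approx_Re_poly:
  assumes "continuous_on (sphere 0 1) g" "0 < (e :: real)"
  obtains p :: "complex poly" where "\<And>z. z \<in> sphere 0 1 \<Longrightarrow> \<bar>g z - Re (poly p z)\<bar> < e"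
proof -
  obtain h where h: "real_polynomial_function h" "\<And>z. z \<in> sphere 0 1 \<Longrightarrow> \<bar>g z - h z\<bar> < e"
    by (rule Stone_Weierstrass_real_polynomial_function[OF compact_sphere assms]) auto
  then show ?thesis
    using that real_polynomial_function_circle_harmonic[OF h(1)] unfolding circle_harmonic_def
    by metis
qed

text \<open>
  Plurisubharmonicity is a local property: it suffices to have the sub-mean value inequality on small
  circles around each point. Given a disc and a continuous majorant \<open>g0\<close> of \<open>f\<close> on its boundary,
  approximate \<open>g0\<close> on the circle by the real part of a polynomial. The maximum principle carries
  the resulting inequality from the circle to the centre, where the value of the real part is its mean.
\<close>
lemma psh_onI_local:
  fixes f :: "'a::real_normed_vector \<Rightarrow> real"
  assumes usc: "usc_on G (\<lambda>x. ereal (f x))" and bd: "\<And>x. x \<in> G \<Longrightarrow> \<bar>f x\<bar> \<le> M"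
    and sc: "\<And>b. continuous_on UNIV (\<lambda>l. sc l b)" "\<And>k l b. sc (k + l) b = sc k b + sc l b"
    and submean: "\<And>x b. x \<in> G \<Longrightarrow> \<exists>R>0. \<forall>r. 0 < r \<and> r < R \<longrightarrow>
      (\<forall>g. continuous_on (sphere 0 1) g \<longrightarrow> (\<forall>l\<in>sphere 0 1. f (x + sc (of_real r * l) b) \<le> g l)
          \<longrightarrow> f x \<le> circle_avg g)"
  shows "psh_on sc G (\<lambda>x. ereal (f x))"
proof (rule psh_onI_majorants[OF usc bd sc(1)])
  fix a b L and G0 :: "'a \<Rightarrow> real"
  assume disc: "\<And>l. norm l \<le> 1 \<Longrightarrow> a + sc l b \<in> G" and lip: "L-lipschitz_on UNIV G0"
    and maj: "\<And>x. x \<in> G \<Longrightarrow> f x \<le> G0 x"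
  define F where "F l = f (a + sc l b)" for l
  define g0 where "g0 l = G0 (a + sc l b)" for l
  have cont_disc: "continuous_on A (\<lambda>l. a + sc l b)" for A
    by (intro continuous_intros continuous_on_subset[OF sc(1)]) auto
  have g0: "continuous_on (sphere 0 1) g0"
    unfolding g0_def by (rule continuous_on_compose2[OF lipschitz_on_continuous_on[OF lip] cont_disc]) auto
  have Fg0: "F l \<le> g0 l" if "norm l \<le> 1" for l unfolding F_def g0_def using maj disc that by blast
  have F0: "F 0 = f a"
  proof -
    have "sc 0 b = 0" using sc(2)[of 0 0 b] by simp
    then show ?thesis by (simp add: F_def)
  qed
  have "f a \<le> circle_avg g0 + e" if e: "e > 0" for e
  proof -
    obtain p :: "complex poly" where p: "\<And>z. z \<in> sphere 0 1 \<Longrightarrow> \<bar>g0 z - Re (poly p z)\<bar> < e / 2"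
      using circle_approx_Re_poly[OF g0, of "e / 2"] e by auto
    have contp: "continuous_on A (\<lambda>z. Re (poly p z))" for A by (intro continuous_intros)
    define H where "H z = ereal (F z) + ereal (- Re (poly p z) - e / 2)" for z
    have "H 0 \<le> 0"
    proof (rule maximum_principle[of "cball 0 1"])
      show "usc_on (cball 0 1) H"
        unfolding H_def F_def
        by (intro usc_on_add_continuous continuous_intros usc_on_compose[OF usc cont_disc])
           (use disc in auto)
      show "H z < \<infinity>" for z by (simp add: H_def)
      fix z :: complex assume z: "z \<in> cball 0 1" and Hz: "0 < H z"
      have "norm z < 1"
      proof (rule ccontr)
        assume "\<not> norm z < 1"
        then have "z \<in> sphere 0 1" using z by simp
        then have "g0 z - Re (poly p z) < e / 2" "F z \<le> g0 z"
          using order.strict_trans1[OF abs_ge_self p] Fg0[of z] by auto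
        moreover have "0 < F z + (- Re (poly p z) - e / 2)" using Hz by (simp add: H_def)
        ultimately show False by linarith
      qed
      have "a + sc z b \<in> G" using disc z by simp
      from submean[OF this, of b] obtain R where R: "R > 0" "\<And>r g. 0 < r \<Longrightarrow> r < R \<Longrightarrow>
         continuous_on (sphere 0 1) g \<Longrightarrow> (\<forall>l\<in>sphere 0 1. f (a + sc z b + sc (of_real r * l) b) \<le> g l)
          \<Longrightarrow> f (a + sc z b) \<le> circle_avg g" by blast
      \<comment> \<open>The circle must stay in the unit disc and be small enough for the local inequality.\<close>
      define r where "r = min (R / 2) (1 - norm z)"
      have r: "0 < r" "r < R" "r \<le> 1 - norm z" using R \<open>norm z < 1\<close> by (auto simp: r_def)
      show "\<exists>r>0. (\<forall>l\<in>sphere 0 1. z + of_real r * l \<in> cball 0 1) \<and>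
        (\<forall>g. continuous_on (sphere 0 1) g \<longrightarrow> (\<forall>l\<in>sphere 0 1. H (z + of_real r * l) \<le> ereal (g l))
          \<longrightarrow> H z \<le> ereal (circle_avg g))"
      proof (intro exI[of _ r] conjI ballI allI impI r)
        fix l :: complex assume l: "l \<in> sphere 0 1"
        have "norm (z + of_real r * l) \<le> norm z + norm (of_real r * l)" by (rule norm_triangle_ineq)
        also have "\<dots> \<le> 1" using l r by (simp add: norm_mult)
        finally show "z + of_real r * l \<in> cball 0 1" by simp
      next
        fix g assume g: "continuous_on (sphere 0 1) g" "\<forall>l\<in>sphere 0 1. H (z + of_real r * l) \<le> ereal (g l)"
        have cp: "continuous_on (sphere 0 1) (\<lambda>l. Re (poly p (z + of_real r * l)))"
          by (rule continuous_on_compose2[OF contp]) (auto intro!: continuous_intros)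
        have "f (a + sc z b) \<le> circle_avg (\<lambda>l. g l + (Re (poly p (z + of_real r * l)) + e / 2))"
        proof (rule R(2)[OF r(1,2)])
          show "continuous_on (sphere 0 1) (\<lambda>l. g l + (Re (poly p (z + of_real r * l)) + e / 2))"
            by (intro continuous_on_add g cp continuous_on_const)
          show "\<forall>l\<in>sphere 0 1. f (a + sc z b + sc (of_real r * l) b)
             \<le> g l + (Re (poly p (z + of_real r * l)) + e / 2)"
          proof
            fix l :: complex assume "l \<in> sphere 0 1"
            with g(2) have "H (z + of_real r * l) \<le> ereal (g l)" by blast
            then show "f (a + sc z b + sc (of_real r * l) b) \<le> g l + (Re (poly p (z + of_real r * l)) + e / 2)"
              by (simp add: H_def F_def sc(2) add.assoc)
          qed
        qed
        also have "\<dots> = circle_avg g + (circle_avg (\<lambda>l. Re (poly p (z + of_real r * l))) + e / 2)"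
          using g cp by (simp add: circle_avg_add continuous_on_add)
        also have "circle_avg (\<lambda>l. Re (poly p (z + of_real r * l))) = Re (poly p (z + of_real r * 0))"
          by (intro circle_avg_Re_holomorphic continuous_intros holomorphic_intros)
        finally show "H z \<le> ereal (circle_avg g)" by (simp add: H_def F_def)
      qed
    qed auto
    then have "f a \<le> Re (poly p 0) + e / 2" by (simp add: H_def F0)
    also have "Re (poly p 0) = circle_avg (\<lambda>l. Re (poly p l))"
      by (rule circle_avg_Re_holomorphic[symmetric]) (auto intro!: continuous_intros holomorphic_intros)
    also have "\<dots> \<le> circle_avg (\<lambda>l. g0 l + e / 2)"
    proof (intro circle_avg_mono contp continuous_intros g0)
      fix l :: complex assume "l \<in> sphere 0 1"
      from p[OF this] show "Re (poly p l) \<le> g0 l + e / 2" by linarith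
    qed
    also have "\<dots> = circle_avg g0 + e / 2" using g0 by (simp add: circle_avg_add)
    finally show ?thesis by simp
  qed
  then show "f a \<le> circle_avg (\<lambda>l. G0 (a + sc l b))"
    using field_le_epsilon unfolding g0_def by metis
qed

lemma psh_onI_continuous:
  fixes f :: "'a::real_normed_vector \<Rightarrow> real"
  assumes cont: "continuous_on G f" and bd: "\<And>x. x \<in> G \<Longrightarrow> \<bar>f x\<bar> \<le> M"
    and sc: "\<And>b. continuous_on UNIV (\<lambda>l. sc l b)"
    and submean: "\<And>a b. (\<And>l. norm l \<le> 1 \<Longrightarrow> a + sc l b \<in> G) \<Longrightarrow> f a \<le> circle_avg (\<lambda>l. f (a + sc l b))"
  shows "psh_on sc G (\<lambda>x. ereal (f x))"
proof (rule psh_onI_majorants[OF continuous_imp_usc_on[OF cont] bd sc])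
  fix a b L and g :: "'a \<Rightarrow> real"
  assume disc: "\<And>l. norm l \<le> 1 \<Longrightarrow> a + sc l b \<in> G" and lip: "L-lipschitz_on UNIV g"
    and maj: "\<And>x. x \<in> G \<Longrightarrow> f x \<le> g x"
  have cont_disc: "continuous_on (sphere 0 1) (\<lambda>l. a + sc l b)"
    by (intro continuous_intros continuous_on_subset[OF sc]) auto
  have "f a \<le> circle_avg (\<lambda>l. f (a + sc l b))" by (rule submean[OF disc])
  also have "\<dots> \<le> circle_avg (\<lambda>l. g (a + sc l b))"
  proof (rule circle_avg_mono)
    show "continuous_on (sphere 0 1) (\<lambda>l. f (a + sc l b))"
      by (rule continuous_on_compose2[OF cont cont_disc]) (use disc in auto)
    show "continuous_on (sphere 0 1) (\<lambda>l. g (a + sc l b))"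
      by (rule continuous_on_compose2[OF lipschitz_on_continuous_on[OF lip] cont_disc]) auto
  qed (use disc maj in auto)
  finally show "f a \<le> circle_avg (\<lambda>l. g (a + sc l b))" .
qed

lemma usc_on_realI:
  assumes "\<And>x e. x \<in> G \<Longrightarrow> 0 < e \<Longrightarrow> \<exists>U. open U \<and> x \<in> U \<and> (\<forall>y\<in>U \<inter> G. f y < f x + e)"
  shows "usc_on G (\<lambda>x. ereal (f x))"
proof (rule usc_onI)
  fix x c assume x: "x \<in> G" and "ereal (f x) < c"
  then obtain d where d: "ereal (f x) < ereal d" "ereal d < c" using ereal_dense2 by blast
  then have "0 < d - f x" by simp
  from assms[OF x this] obtain U where U: "open U" "x \<in> U" "\<forall>y\<in>U \<inter> G. f y < f x + (d - f x)" by blast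
  have "ereal (f y) < c" if "y \<in> U \<inter> G" for y
  proof -
    have "ereal (f y) < ereal d" using U(3) that by simp
    then show ?thesis using d(2) by order
  qed
  then show "\<exists>U. open U \<and> x \<in> U \<and> (\<forall>y\<in>U \<inter> G. ereal (f y) < c)" using U(1,2) by blast
qed

lemma usc_on_realD:
  assumes "usc_on G (\<lambda>x. ereal (f x))" "x \<in> G" "0 < e"
  obtains U where "open U" "x \<in> U" "\<And>y. y \<in> U \<inter> G \<Longrightarrow> f y < f x + e"
proof -
  have "ereal (f x) < ereal (f x + e)" using assms(3) by simp
  from usc_onD[OF assms(1,2) this] that show ?thesis by auto
qed

section \<open>Upper semicontinuous regularization\<close>

lemma usc_regularization_le:
  assumes "open U" "x \<in> U" "\<And>y. y \<in> U \<inter> G \<Longrightarrow> f y \<le> d"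
  shows "usc_regularization G f x \<le> d"
  unfolding usc_regularization_def
proof (rule Limsup_bounded)
  have "eventually (\<lambda>y. y \<in> U) (nhds x)" using assms(1,2) by (rule eventually_nhds_in_open)
  then show "\<forall>\<^sub>F y in inf (nhds x) (principal G). f y \<le> d"
    unfolding eventually_inf_principal by eventually_elim (use assms(3) in auto)
qed

lemma usc_regularization_lessD:
  assumes "usc_regularization G f x < c"
  obtains U d where "open U" "x \<in> U" "d < c" "\<And>y. y \<in> U \<inter> G \<Longrightarrow> f y \<le> d"
proof -
  obtain P where P: "eventually P (inf (nhds x) (principal G))" "(SUP y\<in>Collect P. f y) < c"
    using assms unfolding usc_regularization_def Limsup_def INF_less_iff by auto
  then obtain U where U: "open U" "x \<in> U" "\<forall>y\<in>U. y \<in> G \<longrightarrow> P y"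
    unfolding eventually_inf_principal eventually_nhds by blast
  show ?thesis
  proof (rule that[OF U(1,2) P(2)])
    fix y assume "y \<in> U \<inter> G"
    then show "f y \<le> (SUP y\<in>Collect P. f y)" using U(3) by (intro SUP_upper) auto
  qed
qed

lemma le_usc_regularization:
  assumes "x \<in> G"
  shows "f x \<le> usc_regularization G f x"
proof (rule ccontr)
  assume "\<not> f x \<le> usc_regularization G f x"
  then have "usc_regularization G f x < f x" by simp
  then obtain U d where "open U" "x \<in> U" "d < f x" "\<And>y. y \<in> U \<inter> G \<Longrightarrow> f y \<le> d"
    using usc_regularization_lessD by blast
  then show False using assms by (metis IntI not_le)
qed

lemma usc_on_usc_regularization: "usc_on G (usc_regularization G f)"
proof (rule usc_onI)
  fix x c assume "usc_regularization G f x < c"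
  then obtain U d where U: "open U" "x \<in> U" "d < c" "\<And>y. y \<in> U \<inter> G \<Longrightarrow> f y \<le> d"
    using usc_regularization_lessD by blast
  have "usc_regularization G f y < c" if "y \<in> U" for y
    using usc_regularization_le[of U y G f d] that U by (meson le_less_trans)
  then show "\<exists>U. open U \<and> x \<in> U \<and> (\<forall>y\<in>U \<inter> G. usc_regularization G f y < c)"
    using U(1,2) by blast
qed

lemma usc_regularization_least:
  assumes "usc_on G h" "\<And>y. y \<in> G \<Longrightarrow> f y \<le> h y" "x \<in> G"
  shows "usc_regularization G f x \<le> h x"
proof (rule dense_ge)
  fix c assume "h x < c"
  from usc_onD[OF assms(1,3) this] obtain U where U: "open U" "x \<in> U" "\<forall>y\<in>U \<inter> G. h y < c" by blast
  have "f y \<le> c" if "y \<in> U \<inter> G" for y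
    using assms(2)[of y] U(3) that by (meson IntD2 le_less_trans less_imp_le)
  then show "usc_regularization G f x \<le> c" by (rule usc_regularization_le[OF U(1,2)])
qed

section \<open>The largest plurisubharmonic minorant\<close>

lemma continuous_on_vector_smult: "continuous_on A (\<lambda>l. l *s (v :: complex ^ 'n))"
  unfolding vector_scalar_mult_def by (intro continuous_intros)

lemma continuous_on_prod_scale: "continuous_on A (\<lambda>l. prod_scale l b)"
  unfolding prod_scale_def by (intro continuous_intros continuous_on_vector_smult)

lemma prod_scale_add: "prod_scale (k + l) b = prod_scale k b + prod_scale l b"
  by (simp add: prod_scale_def vector_sadd_rdistrib distrib_right)

lemma prod_scale_mult: "prod_scale (k * l) b = prod_scale l (prod_scale k b)"
  by (simp add: prod_scale_def vector_smult_assoc mult.commute mult.left_commute)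

lemma small_disc_in_open:
  fixes \<gamma> :: "complex \<Rightarrow> 'a::topological_space"
  assumes "open G" "continuous_on UNIV \<gamma>" "\<gamma> 0 \<in> G"
  obtains R where "R > 0" "\<And>r l. 0 < r \<Longrightarrow> r < R \<Longrightarrow> norm l \<le> 1 \<Longrightarrow> \<gamma> (of_real r * l) \<in> G"
proof -
  have "open (\<gamma> -` G)" using assms(1,2) by (rule open_vimage)
  moreover have "0 \<in> \<gamma> -` G" using assms(3) by simp
  ultimately obtain R where R: "R > 0" "ball 0 R \<subseteq> \<gamma> -` G"
    using open_contains_ball by blast
  show ?thesis
  proof (rule that[OF R(1)])
    fix r and l :: complex assume r: "0 < r" "r < R" "norm l \<le> 1"
    have "norm (of_real r * l) = r * norm l" using r by (simp add: norm_mult)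
    also have "\<dots> \<le> r * 1" using r by (intro mult_left_mono) auto
    finally have "norm (of_real r * l) < R" using r by simp
    then show "\<gamma> (of_real r * l) \<in> G" using R(2) by auto
  qed
qed

text \<open>
  The regularized supremum \<open>w\<close> of the family stays below the upper semicontinuous function \<open>h\<close>, so it
  belongs to the family and is its largest element. For its plurisubharmonicity, let \<open>g\<close> be a Lipschitz
  majorant of \<open>w\<close>. The members \<open>v\<close> of the family satisfy \<open>v x \<le> circle_avg (\<lambda>l. g (x + l b))\<close> for all \<open>x\<close>
  near \<open>a\<close>, and the right-hand side varies by at most \<open>L * dist a x\<close>. So the upper limit of the
  supremum at \<open>a\<close> is at most the average around \<open>a\<close>.
\<close>
lemma psh_envelope_properties:
  fixes h :: "(complex ^ 'n) \<times> complex \<Rightarrow> real"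
  assumes "open D" "usc_on D (\<lambda>p. ereal (h p))" and bd: "\<And>p. p \<in> D \<Longrightarrow> \<bar>h p\<bar> \<le> M"
  obtains w :: "(complex ^ 'n) \<times> complex \<Rightarrow> real" where
    "\<And>p. p \<in> D \<Longrightarrow> psh_envelope D (\<lambda>q. ereal (h q)) p = ereal (w p)"
    "psh_on prod_scale D (\<lambda>p. ereal (w p))"
    "\<And>p. p \<in> D \<Longrightarrow> \<bar>w p\<bar> \<le> M" "\<And>p. p \<in> D \<Longrightarrow> w p \<le> h p"
    "\<And>v p. psh_on prod_scale D v \<Longrightarrow> (\<And>q. q \<in> D \<Longrightarrow> v q \<le> ereal (h q)) \<Longrightarrow> p \<in> D \<Longrightarrow> v p \<le> ereal (w p)"
proof -
  define \<F> where "\<F> = {v \<in> PSH_prod D. \<forall>q\<in>D. v q \<le> ereal (h q)}"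
  define P where "P = psh_envelope D (\<lambda>q. ereal (h q))"
  have P: "P = usc_regularization D (\<lambda>p. SUP v\<in>\<F>. v p)"
    unfolding P_def psh_envelope_def \<F>_def ..
  have P_le: "P p \<le> ereal (h p)" if "p \<in> D" for p
    unfolding P by (rule usc_regularization_least[OF assms(2) _ that]) (auto simp: \<F>_def intro: SUP_least)
  have le_P: "v p \<le> P p" if "v \<in> \<F>" "p \<in> D" for v p
  proof -
    have "v p \<le> (SUP v\<in>\<F>. v p)" using that by (intro SUP_upper)
    also have "\<dots> \<le> P p" unfolding P by (rule le_usc_regularization[OF that(2)])
    finally show ?thesis .
  qed
  have "psh_on prod_scale D (\<lambda>p. ereal (- M))"
    by (rule psh_onI_continuous[where M = "\<bar>M\<bar>"]) (auto intro: continuous_on_prod_scale)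
  moreover have "- M \<le> h p" if "p \<in> D" for p using bd[OF that] by linarith
  ultimately have const: "(\<lambda>p. ereal (- M)) \<in> \<F>" by (simp add: \<F>_def)
  define w where "w p = real_of_ereal (P p)" for p
  have bounds: "ereal (- M) \<le> P p" "P p \<le> ereal M" if "p \<in> D" for p
  proof -
    show "ereal (- M) \<le> P p" using le_P[OF const that] .
    have "ereal (h p) \<le> ereal M" using bd[OF that] by (simp add: abs_le_iff)
    with P_le[OF that] show "P p \<le> ereal M" by order
  qed
  have Pw: "P p = ereal (w p)" if "p \<in> D" for p
    using bounds[OF that] by (cases "P p") (auto simp: w_def)
  have wM: "\<bar>w p\<bar> \<le> M" if "p \<in> D" for p
    using bounds[OF that] Pw[OF that] by (simp add: abs_le_iff)
  have "usc_on D P" unfolding P by (rule usc_on_usc_regularization)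
  then have usc: "usc_on D (\<lambda>p. ereal (w p))"
    unfolding usc_on_def using Pw by (simp cong: conj_cong)
  have psh: "psh_on prod_scale D (\<lambda>p. ereal (w p))"
  proof (rule psh_onI_majorants[OF usc wM continuous_on_prod_scale])
    fix a b :: "(complex ^ 'n) \<times> complex" and L and g :: "(complex ^ 'n) \<times> complex \<Rightarrow> real"
    assume disc: "\<And>l. norm l \<le> 1 \<Longrightarrow> a + prod_scale l b \<in> D" and lip: "L-lipschitz_on UNIV g"
      and maj: "\<And>x. x \<in> D \<Longrightarrow> w x \<le> g x"
    define A where "A = circle_avg (\<lambda>l. g (a + prod_scale l b))"
    have L: "L \<ge> 0" by (rule lipschitz_on_nonneg[OF lip])
    have cont: "continuous_on S (\<lambda>l. x + prod_scale l b)" for S x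
      by (intro continuous_intros continuous_on_prod_scale)
    have contg: "continuous_on (sphere 0 1) (\<lambda>l. g (x + prod_scale l b))" for x
      by (rule continuous_on_compose2[OF lipschitz_on_continuous_on[OF lip] cont]) auto
    have "compact ((\<lambda>l. a + prod_scale l b) ` cball 0 1)"
      by (intro compact_continuous_image cont) auto
    moreover have "(\<lambda>l. a + prod_scale l b) ` cball 0 1 \<subseteq> D" using disc by auto
    ultimately obtain d where d: "d > 0" "(\<Union>x\<in>(\<lambda>l. a + prod_scale l b) ` cball 0 1. ball x d) \<subseteq> D"
      using compact_subset_open_imp_ball_epsilon_subset[OF _ assms(1)] by blast
    have aD: "a \<in> D" using disc[of 0] by (simp add: prod_scale_def flip: zero_prod_def)
    have "w a \<le> A + e" if e: "e > 0" for e
    proof -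
      have "P a \<le> ereal (A + e)"
        unfolding P
      proof (rule usc_regularization_le)
        show "open (ball a (min d (e / (L + 1))))" "a \<in> ball a (min d (e / (L + 1)))"
          using d e L by auto
        fix x assume "x \<in> ball a (min d (e / (L + 1))) \<inter> D"
        then have x: "dist a x < d" "dist a x < e / (L + 1)" by auto
        show "(SUP v\<in>\<F>. v x) \<le> ereal (A + e)"
        proof (rule SUP_least)
          fix v assume v: "v \<in> \<F>"
          have discx: "x + prod_scale l b \<in> D" if "norm l \<le> 1" for l
          proof -
            have "x + prod_scale l b \<in> (\<Union>y\<in>(\<lambda>l. a + prod_scale l b) ` cball 0 1. ball y d)"
            proof (rule UN_I)
              show "a + prod_scale l b \<in> (\<lambda>l. a + prod_scale l b) ` cball 0 1" using that by simp
              show "x + prod_scale l b \<in> ball (a + prod_scale l b) d" using x(1) by (simp add: dist_norm)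
            qed
            with d(2) show ?thesis by (rule subsetD)
          qed
          have "v x \<le> ereal (circle_avg (\<lambda>l. g (x + prod_scale l b)))"
          proof (rule psh_on_le_circle_avg[where sc = prod_scale and b = b])
            show "psh_on prod_scale D v" using v by (simp add: \<F>_def)
            show "x + prod_scale l b \<in> D" if "norm l \<le> 1" for l by (rule discx[OF that])
            show "continuous_on (sphere 0 1) (\<lambda>l. g (x + prod_scale l b))" by (rule contg)
            fix l :: complex assume "l \<in> sphere 0 1"
            then have D: "x + prod_scale l b \<in> D" using discx by simp
            have "v (x + prod_scale l b) \<le> ereal (w (x + prod_scale l b))" using le_P[OF v D] Pw[OF D] by simp
            also have "\<dots> \<le> ereal (g (x + prod_scale l b))" using maj[OF D] by simp
            finally show "v (x + prod_scale l b) \<le> ereal (g (x + prod_scale l b))" .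
          qed
          also have "circle_avg (\<lambda>l. g (x + prod_scale l b)) \<le> circle_avg (\<lambda>l. g (a + prod_scale l b) + L * dist a x)"
          proof (rule circle_avg_mono[OF contg])
            show "continuous_on (sphere 0 1) (\<lambda>l. g (a + prod_scale l b) + L * dist a x)"
              by (intro continuous_intros contg)
            fix l :: complex
            have "dist (g (x + prod_scale l b)) (g (a + prod_scale l b)) \<le> L * dist (x + prod_scale l b) (a + prod_scale l b)"
              by (rule lipschitz_onD[OF lip]) auto
            then show "g (x + prod_scale l b) \<le> g (a + prod_scale l b) + L * dist a x"
              by (simp add: dist_real_def abs_le_iff dist_commute)
          qed
          also have "\<dots> = A + L * dist a x" unfolding A_def using contg by (simp add: circle_avg_add)
          also have "\<dots> \<le> A + e"
          proof -
            have "L * dist a x \<le> (L + 1) * dist a x" using L by (intro mult_right_mono) auto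
            also have "\<dots> \<le> e" using x(2) L by (simp add: field_simps)
            finally show ?thesis by simp
          qed
          finally show "v x \<le> ereal (A + e)" by simp
        qed
      qed
      then show ?thesis using Pw[OF aD] by simp
    qed
    then have "w a \<le> A" by (rule field_le_epsilon)
    then show "w a \<le> circle_avg (\<lambda>l. g (a + prod_scale l b))" unfolding A_def .
  qed
  show ?thesis
  proof (rule that[OF _ psh wM])
    show "psh_envelope D (\<lambda>q. ereal (h q)) p = ereal (w p)" if "p \<in> D" for p using Pw[OF that] by (simp add: P_def)
    show "w p \<le> h p" if "p \<in> D" for p using P_le[OF that] Pw[OF that] by simp
    show "v p \<le> ereal (w p)"
      if "psh_on prod_scale D v" "\<And>q. q \<in> D \<Longrightarrow> v q \<le> ereal (h q)" "p \<in> D" for v p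
      using le_P[of v p] Pw[of p] that by (simp add: \<F>_def)
  qed
qed

section \<open>Continuity by translation\<close>

text \<open>
  Walsh's argument for the continuity of a largest plurisubharmonic minorant \<open>w\<close> of \<open>h\<close>. Translate \<open>w\<close> by
  \<open>y = q' - q\<close>, lower it by \<open>2 e\<close>, and glue it to \<open>w\<close> by taking the maximum wherever the translate is
  defined. The result \<open>v\<close> lies below \<open>h\<close> by the uniform continuity of \<open>h\<close>. Points \<open>p\<close> of \<open>D\<close> with \<open>p + y\<close>
  outside \<open>D\<close> are close to the frontier, where \<open>w\<close> is almost \<open>h\<close> and the translate does not exceed \<open>w\<close>;
  hence \<open>v\<close> is upper semicontinuous across the edge of the gluing region. By maximality \<open>v \<le> w\<close>, which is
  the estimate. The sub-mean value inequality for \<open>v\<close> is obtained on small circles only, whence the local criterion.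
\<close>
lemma walsh_translation:
  fixes w h :: "'a::real_normed_vector \<Rightarrow> real"
  assumes D: "open D" and psh: "psh_on sc D (\<lambda>p. ereal (w p))" and bd: "\<And>p. p \<in> D \<Longrightarrow> \<bar>w p\<bar> \<le> M"
    and wh: "\<And>p. p \<in> D \<Longrightarrow> w p \<le> h p"
    and maximal: "\<And>v p. psh_on sc D (\<lambda>p. ereal (v p)) \<Longrightarrow> (\<And>q. q \<in> D \<Longrightarrow> v q \<le> h q) \<Longrightarrow> p \<in> D \<Longrightarrow> v p \<le> w p"
    and sc: "\<And>b. continuous_on UNIV (\<lambda>l. sc l b)" "\<And>k l b. sc (k + l) b = sc k b + sc l b"
      "\<And>k l b. sc (k * l) b = sc l (sc k b)"
    and e: "0 < e"
    and bdry: "\<And>q p. q \<in> D \<Longrightarrow> p \<in> frontier D \<Longrightarrow> dist q p < \<delta> \<Longrightarrow> h q - e \<le> w q"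
    and unif: "\<And>q q'. q \<in> D \<Longrightarrow> q' \<in> D \<Longrightarrow> dist q q' < \<delta> \<Longrightarrow> h q' \<le> h q + e"
    and q: "q \<in> D" "q' \<in> D" "dist q q' < \<delta>"
  shows "w q' \<le> w q + 2 * e"
proof -
  define y where "y = q' - q"
  have y: "norm y < \<delta>" using q(3) by (simp add: y_def dist_norm norm_minus_commute)
  \<comment> \<open>Off the domain of the translate, \<open>v\<close> falls back to \<open>w\<close>.\<close>
  define v where "v p = (if p + y \<in> D then max (w p) (w (p + y) - 2 * e) else w p)" for p
  have usc: "usc_on D (\<lambda>p. ereal (w p))" using psh by (simp add: psh_on_def)
  have hy: "w (p + y) - 2 * e \<le> h p - e" if "p \<in> D" "p + y \<in> D" for p
    using wh[OF that(2)] unif[OF that] y by (simp add: dist_norm)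
  have vh: "v p \<le> h p" if "p \<in> D" for p
    using hy[OF that] wh[OF that] e by (auto simp: v_def)
  have wv: "w p \<le> v p" for p by (simp add: v_def)
  have sc0: "sc 0 b = 0" for b using sc(2)[of 0 0 b] by simp
  have "psh_on sc D (\<lambda>p. ereal (v p))"
  proof (rule psh_onI_local)
    show "\<bar>v p\<bar> \<le> M + 2 * e" if "p \<in> D" for p
      using bd[OF that] bd[of "p + y"] e by (auto simp: v_def max_def abs_le_iff)
    show "usc_on D (\<lambda>p. ereal (v p))"
    proof (rule usc_on_realI)
      fix p and c :: real assume p: "p \<in> D" and c: "0 < c"
      obtain U where U: "open U" "p \<in> U" "\<And>x. x \<in> U \<inter> D \<Longrightarrow> w x < w p + c"
        using usc_on_realD[OF usc p c] by blast
      show "\<exists>U. open U \<and> p \<in> U \<and> (\<forall>x\<in>U \<inter> D. v x < v p + c)"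
      proof (cases "p + y \<in> D")
        case True
        obtain V where V: "open V" "p + y \<in> V" "\<And>x. x \<in> V \<inter> D \<Longrightarrow> w x < w (p + y) + c"
          using usc_on_realD[OF usc True c] by blast
        define N where "N = U \<inter> (\<lambda>x. x + y) -` (V \<inter> D)"
        have "open N" unfolding N_def
          by (intro open_Int U open_vimage V D continuous_intros)
        moreover have "p \<in> N" using U V True by (simp add: N_def)
        moreover have "v x < v p + c" if "x \<in> N \<inter> D" for x
        proof -
          have "w x < w p + c" "w (x + y) < w (p + y) + c" "x + y \<in> D"
            using U(3)[of x] V(3)[of "x + y"] that by (auto simp: N_def)
          then show ?thesis using True by (auto simp: v_def max_def)
        qed
        ultimately show ?thesis by blast
      next
        case False
        \<comment> \<open>The segment to the point \<open>p + y\<close> outside \<open>D\<close> crosses the frontier at distance at most \<open>norm y\<close>.\<close>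
        have "closed_segment p (p + y) \<inter> frontier D \<noteq> {}"
          using p False by (intro connected_Int_frontier) auto
        then obtain b where b: "b \<in> closed_segment p (p + y)" "b \<in> frontier D" by blast
        have "dist p b \<le> norm y" using segment_bound1[OF b(1)] by (simp add: dist_norm norm_minus_commute)
        then have pb: "dist p b < \<delta>" using y by simp
        define N where "N = U \<inter> ball b \<delta>"
        have "v x = w x" if "x \<in> N \<inter> D" for x
        proof -
          have "h x - e \<le> w x" using bdry[of x b] b(2) that by (auto simp: N_def dist_commute)
          then show ?thesis using hy[of x] that by (auto simp: v_def)
        qed
        moreover have "v p = w p" using False by (simp add: v_def)
        ultimately have "\<forall>x\<in>N \<inter> D. v x < v p + c" using U(3) by (auto simp: N_def)
        moreover have "open N" "p \<in> N" using U pb by (auto simp: N_def dist_commute)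
        ultimately show ?thesis by blast
      qed
    qed
    show "\<exists>R>0. \<forall>r. 0 < r \<and> r < R \<longrightarrow>
        (\<forall>g. continuous_on (sphere 0 1) g \<longrightarrow> (\<forall>l\<in>sphere 0 1. v (p + sc (of_real r * l) b) \<le> g l)
          \<longrightarrow> v p \<le> circle_avg g)" if p: "p \<in> D" for p b
    \<comment> \<open>Where \<open>v = w\<close>, the inequality for \<open>w\<close> suffices because \<open>w \<le> v\<close> everywhere;
      otherwise the translate is active and its domain is open.\<close>
    proof (cases "v p = w p")
      case True
      obtain R where R: "R > 0" "\<And>r l. 0 < r \<Longrightarrow> r < R \<Longrightarrow> norm l \<le> 1 \<Longrightarrow> p + sc (of_real r * l) b \<in> D"
        by (rule small_disc_in_open[OF D, of "\<lambda>l. p + sc l b"]) (auto intro!: continuous_intros sc(1) simp: sc0 p)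
      show ?thesis
      proof (intro exI[of _ R] conjI allI impI R(1))
        fix r g assume r: "0 < r \<and> r < R" and g: "continuous_on (sphere 0 1) g"
          and vg: "\<forall>l\<in>sphere 0 1. v (p + sc (of_real r * l) b) \<le> g l"
        have "ereal (w p) \<le> ereal (circle_avg g)"
        proof (rule psh_on_le_circle_avg[where b = "sc (of_real r) b", OF psh _ g])
          show "p + sc l (sc (of_real r) b) \<in> D" if "norm l \<le> 1" for l
            using R(2)[of r l] r that by (simp add: sc(3))
          show "ereal (w (p + sc l (sc (of_real r) b))) \<le> ereal (g l)" if "l \<in> sphere 0 1" for l
            using vg that wv order_trans by (fastforce simp: sc(3))
        qed
        then show "v p \<le> circle_avg g" using True by simp
      qed
    next
      case False
      then have py: "p + y \<in> D" and vp: "v p = w (p + y) - 2 * e"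
        by (auto simp: v_def max_def split: if_splits)
      obtain R where R: "R > 0" "\<And>r l. 0 < r \<Longrightarrow> r < R \<Longrightarrow> norm l \<le> 1 \<Longrightarrow> p + y + sc (of_real r * l) b \<in> D"
        by (rule small_disc_in_open[OF D, of "\<lambda>l. p + y + sc l b"]) (auto intro!: continuous_intros sc(1) simp: sc0 py)
      show ?thesis
      proof (intro exI[of _ R] conjI allI impI R(1))
        fix r g assume r: "0 < r \<and> r < R" and g: "continuous_on (sphere 0 1) g"
          and vg: "\<forall>l\<in>sphere 0 1. v (p + sc (of_real r * l) b) \<le> g l"
        have "ereal (w (p + y)) \<le> ereal (circle_avg (\<lambda>l. g l + 2 * e))"
        proof (rule psh_on_le_circle_avg[where b = "sc (of_real r) b", OF psh])
          show "continuous_on (sphere 0 1) (\<lambda>l. g l + 2 * e)" by (intro continuous_intros g)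
          show D': "p + y + sc l (sc (of_real r) b) \<in> D" if "norm l \<le> 1" for l
            using R(2)[of r l] r that by (simp add: sc(3))
          show "ereal (w (p + y + sc l (sc (of_real r) b))) \<le> ereal (g l + 2 * e)" if l: "l \<in> sphere 0 1" for l
          proof -
            have "p + sc (of_real r * l) b + y \<in> D" using D'[of l] l by (simp add: sc(3) add_ac)
            then have "w (p + sc (of_real r * l) b + y) - 2 * e \<le> v (p + sc (of_real r * l) b)" by (simp add: v_def)
            also have "\<dots> \<le> g l" using vg l by blast
            finally show ?thesis by (simp add: sc(3) add_ac)
          qed
        qed
        also have "circle_avg (\<lambda>l. g l + 2 * e) = circle_avg g + 2 * e" using g by (simp add: circle_avg_add)
        finally show "v p \<le> circle_avg g" by (simp add: vp)
      qed
    qed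
  qed (use sc in auto)
  from maximal[OF this vh q(1)] have "v q \<le> w q" .
  moreover have "w (q + y) - 2 * e \<le> v q" using q by (simp add: v_def y_def)
  ultimately show ?thesis by (simp add: y_def)
qed

section \<open>The annulus and its boundary circles\<close>

lemma mem_annulus: "\<zeta> \<in> annulus \<longleftrightarrow> 1 < norm \<zeta> \<and> norm \<zeta> < exp 1"
proof (cases "\<zeta> = 0")
  case False
  then have "ln (norm \<zeta>) < 1 \<longleftrightarrow> norm \<zeta> < exp 1" by (metis exp_less_cancel_iff exp_ln zero_less_norm_iff)
  then show ?thesis using False by (auto simp: annulus_def ln_gt_zero_iff)
qed (auto simp: annulus_def)

lemma open_annulus: "open annulus"
proof -
  have "annulus = (\<lambda>\<zeta>. norm \<zeta>) -` {1<..<exp 1}" by (auto simp: mem_annulus)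
  then show ?thesis by (metis continuous_on_norm_id open_greaterThanLessThan open_vimage)
qed

lemma closure_annulus_bounds:
  assumes "\<zeta> \<in> closure annulus"
  shows "\<zeta> \<noteq> 0" "0 \<le> ln (norm \<zeta>)" "ln (norm \<zeta>) \<le> 1"
proof -
  have "closure annulus \<subseteq> {\<zeta>. 1 \<le> norm \<zeta> \<and> norm \<zeta> \<le> exp 1}"
    by (rule closure_minimal) (auto simp: mem_annulus intro!: closed_Collect_conj closed_Collect_le continuous_intros)
  then have *: "1 \<le> norm \<zeta>" "norm \<zeta> \<le> exp 1" using assms by auto
  then show "\<zeta> \<noteq> 0" "0 \<le> ln (norm \<zeta>)" by auto
  have "ln (norm \<zeta>) \<le> ln (exp 1)" using * by (intro ln_mono) auto
  then show "ln (norm \<zeta>) \<le> 1" by simp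
qed

lemma bounded_annulus: "bounded annulus"
  by (rule boundedI[of _ "exp 1"]) (auto simp: mem_annulus)

lemma \<Psi>_eq: "\<Psi> u0 u1 (z, \<zeta>) = u0 z + (u1 z - u0 z) * ln (norm \<zeta>)"
  by (simp add: \<Psi>_def algebra_simps)

lemma convex_comb_bounds:
  fixes a b t M :: real
  assumes "0 \<le> t" "t \<le> 1" "\<bar>a\<bar> \<le> M" "\<bar>b\<bar> \<le> M"
  shows "\<bar>a + (b - a) * t\<bar> \<le> M"
proof -
  have "a + (b - a) * t = (1 - t) * a + t * b" by (simp add: algebra_simps)
  also have "\<bar>\<dots>\<bar> \<le> (1 - t) * \<bar>a\<bar> + t * \<bar>b\<bar>"
    using assms(1,2) by (intro order_trans[OF abs_triangle_ineq]) (simp add: abs_mult)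
  also have "\<dots> \<le> (1 - t) * M + t * M" using assms by (intro add_mono mult_left_mono) auto
  finally show ?thesis by (simp add: algebra_simps)
qed

lemma circle_avg_affine_ln_norm:
  assumes "\<And>l. norm l \<le> 1 \<Longrightarrow> a + l * b \<noteq> 0"
  shows "circle_avg (\<lambda>l. \<alpha> + \<beta> * ln (norm (a + l * b))) = \<alpha> + \<beta> * ln (norm a)"
    and "continuous_on (sphere 0 1) (\<lambda>l. \<alpha> + \<beta> * ln (norm (a + l * b)))"
proof -
  have c: "continuous_on (sphere 0 1) (\<lambda>l. \<beta> * ln (norm (a + l * b)))"
    using assms by (intro continuous_intros) auto
  then show "continuous_on (sphere 0 1) (\<lambda>l. \<alpha> + \<beta> * ln (norm (a + l * b)))"
    by (intro continuous_on_add continuous_on_const)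
  show "circle_avg (\<lambda>l. \<alpha> + \<beta> * ln (norm (a + l * b))) = \<alpha> + \<beta> * ln (norm a)"
    using c by (simp add: circle_avg_add circle_avg_cmult circle_avg_ln_norm[OF assms])
qed

lemma eventually_to_circle:
  "eventually P (to_circle j) \<longleftrightarrow> (\<exists>d>0. \<forall>\<zeta>\<in>annulus. \<bar>ln (norm \<zeta>) - j\<bar> < d \<longrightarrow> P \<zeta>)"
proof
  assume "eventually P (to_circle j)"
  then obtain Q where Q: "eventually Q (nhds j)" "\<And>\<zeta>. Q (ln (norm \<zeta>)) \<Longrightarrow> \<zeta> \<in> annulus \<Longrightarrow> P \<zeta>"
    unfolding to_circle_def eventually_inf_principal eventually_filtercomap by blast
  then show "\<exists>d>0. \<forall>\<zeta>\<in>annulus. \<bar>ln (norm \<zeta>) - j\<bar> < d \<longrightarrow> P \<zeta>"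
    unfolding eventually_nhds_metric dist_real_def by blast
next
  assume "\<exists>d>0. \<forall>\<zeta>\<in>annulus. \<bar>ln (norm \<zeta>) - j\<bar> < d \<longrightarrow> P \<zeta>"
  then obtain d where d: "d > 0" "\<forall>\<zeta>\<in>annulus. \<bar>ln (norm \<zeta>) - j\<bar> < d \<longrightarrow> P \<zeta>" by blast
  have "eventually (\<lambda>t. \<bar>t - j\<bar> < d) (nhds j)"
    using d(1) unfolding eventually_nhds_metric dist_real_def by blast
  then show "eventually P (to_circle j)"
    unfolding to_circle_def eventually_inf_principal eventually_filtercomap using d(2) by blast
qed

text \<open>
  Passing to the limit in an affine function of \<open>ln |\<zeta>|\<close>; at \<open>j = 0, 1\<close> such functions take the boundary
  values \<open>u0 z\<close> and \<open>u1 z\<close> when they interpolate between them.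
\<close>
lemma Limsup_to_circle_bound:
  assumes "\<And>\<zeta>. \<zeta> \<in> annulus \<Longrightarrow> f \<zeta> \<le> ereal (\<alpha> + \<beta> * ln (norm \<zeta>))"
  shows "Limsup (to_circle j) f \<le> ereal (\<alpha> + \<beta> * j)"
proof (rule ereal_le_epsilon2[rule_format])
  fix e :: real assume e: "e > 0"
  show "Limsup (to_circle j) f \<le> ereal (\<alpha> + \<beta> * j) + ereal e"
  proof (rule Limsup_bounded)
    show "\<forall>\<^sub>F \<zeta> in to_circle j. f \<zeta> \<le> ereal (\<alpha> + \<beta> * j) + ereal e"
      unfolding eventually_to_circle
    proof (intro exI[of _ "e / (\<bar>\<beta>\<bar> + 1)"] conjI ballI impI)
      show "0 < e / (\<bar>\<beta>\<bar> + 1)" using e by simp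
      fix \<zeta> assume \<zeta>: "\<zeta> \<in> annulus" "\<bar>ln (norm \<zeta>) - j\<bar> < e / (\<bar>\<beta>\<bar> + 1)"
      have "\<beta> * (ln (norm \<zeta>) - j) \<le> \<bar>\<beta>\<bar> * \<bar>ln (norm \<zeta>) - j\<bar>" by (metis abs_ge_self abs_mult)
      also have "\<dots> \<le> (\<bar>\<beta>\<bar> + 1) * \<bar>ln (norm \<zeta>) - j\<bar>" by (intro mult_right_mono) auto
      also have "\<dots> \<le> e" using \<zeta>(2) by (simp add: pos_less_divide_eq mult.commute)
      finally have "\<alpha> + \<beta> * ln (norm \<zeta>) \<le> \<alpha> + \<beta> * j + e" by (simp add: algebra_simps)
      then have "ereal (\<alpha> + \<beta> * ln (norm \<zeta>)) \<le> ereal (\<alpha> + \<beta> * j) + ereal e" by simp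
      with assms[OF \<zeta>(1)] show "f \<zeta> \<le> ereal (\<alpha> + \<beta> * j) + ereal e" by order
    qed
  qed
qed

lemma Limsup_to_circle_lessD:
  assumes "Limsup (to_circle j) f \<le> ereal (\<alpha> + \<beta> * j)" "0 < e"
  obtains d where "d > 0" "\<And>\<zeta>. \<zeta> \<in> annulus \<Longrightarrow> \<bar>ln (norm \<zeta>) - j\<bar> < d \<Longrightarrow> f \<zeta> \<le> ereal (\<alpha> + \<beta> * ln (norm \<zeta>) + e)"
proof -
  have "Limsup (to_circle j) f < ereal (\<alpha> + \<beta> * j + e / 2)"
    using assms by (intro le_less_trans[OF assms(1)]) simp
  then have "\<forall>\<^sub>F \<zeta> in to_circle j. f \<zeta> < ereal (\<alpha> + \<beta> * j + e / 2)" by (rule Limsup_lessD)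
  then obtain d where d: "d > 0" "\<And>\<zeta>. \<zeta> \<in> annulus \<Longrightarrow> \<bar>ln (norm \<zeta>) - j\<bar> < d \<Longrightarrow> f \<zeta> < ereal (\<alpha> + \<beta> * j + e / 2)"
    unfolding eventually_to_circle by blast
  show ?thesis
  proof (rule that[of "min d (e / (2 * (\<bar>\<beta>\<bar> + 1)))"])
    show "0 < min d (e / (2 * (\<bar>\<beta>\<bar> + 1)))" using d assms by simp
    fix \<zeta> assume \<zeta>: "\<zeta> \<in> annulus" "\<bar>ln (norm \<zeta>) - j\<bar> < min d (e / (2 * (\<bar>\<beta>\<bar> + 1)))"
    have "\<beta> * (j - ln (norm \<zeta>)) \<le> \<bar>\<beta>\<bar> * \<bar>ln (norm \<zeta>) - j\<bar>" by (metis abs_ge_self abs_mult abs_minus_commute)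
    also have "\<dots> \<le> (\<bar>\<beta>\<bar> + 1) * \<bar>ln (norm \<zeta>) - j\<bar>" by (intro mult_right_mono) auto
    also have "\<dots> \<le> e / 2" using \<zeta>(2) by (simp add: field_simps)
    finally have "\<alpha> + \<beta> * j + e / 2 \<le> \<alpha> + \<beta> * ln (norm \<zeta>) + e" by (simp add: algebra_simps)
    then have "ereal (\<alpha> + \<beta> * j + e / 2) \<le> ereal (\<alpha> + \<beta> * ln (norm \<zeta>) + e)" by simp
    moreover have "f \<zeta> < ereal (\<alpha> + \<beta> * j + e / 2)" using d(2)[OF \<zeta>(1)] \<zeta>(2) by simp
    ultimately show "f \<zeta> \<le> ereal (\<alpha> + \<beta> * ln (norm \<zeta>) + e)" by order
  qed
qed

section \<open>Equality of the two envelopes\<close>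

text \<open>
  For fixed \<open>z\<close> the function \<open>\<Psi> u0 u1 (z, \<zeta>)\<close> is harmonic in \<open>\<zeta>\<close> with the constant boundary values \<open>u0 z\<close> and
  \<open>u1 z\<close>, while \<open>v (z, \<zeta>)\<close> is subharmonic with smaller upper limits. The maximum principle
  compares them on a closed annulus \<open>K\<close> inside \<open>annulus\<close> that contains \<open>\<zeta>0\<close> and is so large that
  \<open>v \<le> \<Psi> + e\<close> holds near its two boundary circles.
\<close>
lemma W_le_\<Psi>:
  assumes v: "v \<in> W \<Omega> u0 u1" and z: "z \<in> \<Omega>" and \<zeta>0: "\<zeta>0 \<in> annulus"
  shows "v (z, \<zeta>0) \<le> ereal (\<Psi> u0 u1 (z, \<zeta>0))"
proof -
  have psh: "psh_on prod_scale (\<Omega> \<times> annulus) v" using v by (simp add: W_def)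
  define \<alpha> \<beta> where "\<alpha> = u0 z" and "\<beta> = u1 z - u0 z"
  define h where "h \<zeta> = \<alpha> + \<beta> * ln (norm \<zeta>)" for \<zeta> :: complex
  have \<Psi>h: "\<Psi> u0 u1 (z, \<zeta>) = h \<zeta>" for \<zeta> by (simp add: \<Psi>_eq h_def \<alpha>_def \<beta>_def)
  have "v (z, \<zeta>0) \<le> ereal (h \<zeta>0) + ereal e" if e: "e > 0" for e
  proof -
    have lim0: "Limsup (to_circle 0) (\<lambda>\<zeta>. v (z, \<zeta>)) \<le> ereal (\<alpha> + \<beta> * 0)"
      and lim1: "Limsup (to_circle 1) (\<lambda>\<zeta>. v (z, \<zeta>)) \<le> ereal (\<alpha> + \<beta> * 1)"
      using v z by (auto simp: W_def \<alpha>_def \<beta>_def)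
    obtain d0 where d0: "d0 > 0" "\<And>\<zeta>. \<zeta> \<in> annulus \<Longrightarrow> \<bar>ln (norm \<zeta>) - 0\<bar> < d0 \<Longrightarrow> v (z, \<zeta>) \<le> ereal (h \<zeta> + e)"
      using Limsup_to_circle_lessD[OF lim0 e] unfolding h_def by blast
    obtain d1 where d1: "d1 > 0" "\<And>\<zeta>. \<zeta> \<in> annulus \<Longrightarrow> \<bar>ln (norm \<zeta>) - 1\<bar> < d1 \<Longrightarrow> v (z, \<zeta>) \<le> ereal (h \<zeta> + e)"
      using Limsup_to_circle_lessD[OF lim1 e] unfolding h_def by blast
    have t0: "0 < ln (norm \<zeta>0)" "ln (norm \<zeta>0) < 1" using \<zeta>0 by (auto simp: annulus_def)
    obtain s where s: "0 < s" "s < d0" "s < d1" "s < ln (norm \<zeta>0)" "s < 1 - ln (norm \<zeta>0)"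
      using field_lbound_gt_zero[of "min d0 d1" "min (ln (norm \<zeta>0)) (1 - ln (norm \<zeta>0))"] d0(1) d1(1) t0 by auto
    define K where "K = {\<zeta> :: complex. exp s \<le> norm \<zeta> \<and> norm \<zeta> \<le> exp (1 - s)}"
    define K' where "K' = {\<zeta> :: complex. exp s < norm \<zeta> \<and> norm \<zeta> < exp (1 - s)}"
    have ln_bounds: "s \<le> ln (norm \<zeta>)" "ln (norm \<zeta>) \<le> 1 - s" "\<zeta> \<noteq> 0" if "\<zeta> \<in> K" for \<zeta>
    proof -
      have n: "exp s \<le> norm \<zeta>" "norm \<zeta> \<le> exp (1 - s)" using that by (auto simp: K_def)
      then have pos: "0 < norm \<zeta>" using exp_gt_zero[of s] by linarith
      then show "\<zeta> \<noteq> 0" by simp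
      show "s \<le> ln (norm \<zeta>)" using pos n(1) by (simp add: ln_ge_iff)
      show "ln (norm \<zeta>) \<le> 1 - s" using pos n(2) by (metis exp_le_cancel_iff exp_ln)
    qed
    have mem_K': "\<zeta> \<in> K'" if "\<zeta> \<noteq> 0" "s < ln (norm \<zeta>)" "ln (norm \<zeta>) < 1 - s" for \<zeta>
      using that unfolding K'_def by (auto, metis exp_less_cancel_iff exp_ln zero_less_norm_iff)+
    have KA: "\<zeta> \<in> annulus" if "\<zeta> \<in> K" for \<zeta>
    proof -
      have "0 < ln (norm \<zeta>) \<and> ln (norm \<zeta>) < 1" using ln_bounds(1,2)[OF that] s(1) by linarith
      then show ?thesis by (simp only: annulus_def mem_Collect_eq)
    qed
    have "K' \<subseteq> K" by (auto simp: K_def K'_def)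
    have "open K'" unfolding K'_def
      by (intro open_Collect_conj open_Collect_less continuous_intros)
    have "compact K"
    proof -
      have "closed K" unfolding K_def
        by (intro closed_Collect_conj closed_Collect_le continuous_intros)
      moreover have "bounded K" by (rule boundedI[of _ "exp (1 - s)"]) (auto simp: K_def)
      ultimately show ?thesis by (simp add: compact_eq_bounded_closed)
    qed
    have "\<zeta>0 \<in> K'" using s t0 by (intro mem_K') auto
    define H where "H \<zeta> = v (z, \<zeta>) + ereal (- h \<zeta> - e)" for \<zeta>
    have "H \<zeta>0 \<le> 0"
    proof (rule maximum_principle[OF \<open>compact K\<close>])
      show "\<zeta>0 \<in> K" using \<open>\<zeta>0 \<in> K'\<close> \<open>K' \<subseteq> K\<close> by blast
      show "usc_on K H"
        unfolding H_def h_def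
      proof (intro usc_on_add_continuous)
        show "usc_on K (\<lambda>\<zeta>. v (z, \<zeta>))"
          by (rule usc_on_compose[of "\<Omega> \<times> annulus"])
             (use psh KA z in \<open>auto simp: psh_on_def intro!: continuous_intros\<close>)
        show "continuous_on K (\<lambda>\<zeta>. - (\<alpha> + \<beta> * ln (norm \<zeta>)) - e)"
          using ln_bounds(3) by (intro continuous_intros) auto
      qed
      show "H \<zeta> < \<infinity>" if "\<zeta> \<in> K" for \<zeta>
      proof -
        have "v (z, \<zeta>) < \<infinity>" using psh z KA[OF that] by (auto simp: psh_on_def)
        then show ?thesis by (cases "v (z, \<zeta>)") (auto simp: H_def)
      qed
      fix \<zeta> assume \<zeta>: "\<zeta> \<in> K" "0 < H \<zeta>"
      have nle: "\<not> v (z, \<zeta>) \<le> ereal (h \<zeta> + e)"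
        using \<zeta>(2) by (cases "v (z, \<zeta>)") (auto simp: H_def)
      have "\<zeta> \<in> K'"
      proof (rule mem_K')
        show "\<zeta> \<noteq> 0" by (rule ln_bounds[OF \<zeta>(1)])
        show "s < ln (norm \<zeta>)" using d0(2)[OF KA[OF \<zeta>(1)]] nle s ln_bounds[OF \<zeta>(1)] by fastforce
        show "ln (norm \<zeta>) < 1 - s" using d1(2)[OF KA[OF \<zeta>(1)]] nle s ln_bounds[OF \<zeta>(1)] by fastforce
      qed
      then obtain r where r: "r > 0" "cball \<zeta> r \<subseteq> K'"
        using \<open>open K'\<close> open_contains_cball by blast
      have disc: "\<zeta> + l * of_real r \<in> K" if "norm l \<le> 1" for l
      proof -
        have "norm (l * of_real r) \<le> 1 * r" using that r(1) unfolding norm_mult by (intro mult_mono) auto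
        then have "\<zeta> + l * of_real r \<in> cball \<zeta> r" by (simp add: dist_norm)
        then show ?thesis using r(2) \<open>K' \<subseteq> K\<close> by blast
      qed
      show "\<exists>r>0. (\<forall>l\<in>sphere 0 1. \<zeta> + of_real r * l \<in> K) \<and>
        (\<forall>g. continuous_on (sphere 0 1) g \<longrightarrow> (\<forall>l\<in>sphere 0 1. H (\<zeta> + of_real r * l) \<le> ereal (g l))
          \<longrightarrow> H \<zeta> \<le> ereal (circle_avg g))"
      proof (intro exI[of _ r] conjI ballI allI impI r(1))
        show "\<zeta> + of_real r * l \<in> K" if "l \<in> sphere 0 1" for l
          using disc[of l] that by (simp add: mult.commute)
        fix g assume g: "continuous_on (sphere 0 1) g" "\<forall>l\<in>sphere 0 1. H (\<zeta> + of_real r * l) \<le> ereal (g l)"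
        have nz: "\<zeta> + l * of_real r \<noteq> 0" if "norm l \<le> 1" for l using ln_bounds(3)[OF disc[OF that]] .
        note avg_h = circle_avg_affine_ln_norm[OF nz, where \<alpha> = \<alpha> and \<beta> = \<beta>, folded h_def]
        have "v (z, \<zeta>) \<le> ereal (circle_avg (\<lambda>l. g l + (h (\<zeta> + l * of_real r) + e)))"
        proof (rule psh_on_le_circle_avg[OF psh, where b = "(0, of_real r)"])
          show "(z, \<zeta>) + prod_scale l (0, of_real r) \<in> \<Omega> \<times> annulus" if "norm l \<le> 1" for l
            using z KA[OF disc[OF that]] by (simp add: prod_scale_def)
          show "continuous_on (sphere 0 1) (\<lambda>l. g l + (h (\<zeta> + l * of_real r) + e))"
            by (intro continuous_on_add g(1) avg_h(2) continuous_on_const)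
          fix l :: complex assume l: "l \<in> sphere 0 1"
          have "H (\<zeta> + l * of_real r) \<le> ereal (g l)" using g(2) l by (metis mult.commute)
          then have "v (z, \<zeta> + l * of_real r) \<le> ereal (g l + (h (\<zeta> + l * of_real r) + e))"
            by (cases "v (z, \<zeta> + l * of_real r)") (auto simp: H_def)
          then show "v ((z, \<zeta>) + prod_scale l (0, of_real r)) \<le> ereal (g l + (h (\<zeta> + l * of_real r) + e))"
            by (simp add: prod_scale_def)
        qed
        also have "circle_avg (\<lambda>l. g l + (h (\<zeta> + l * of_real r) + e)) = circle_avg g + (h \<zeta> + e)"
          using g(1) avg_h by (simp add: circle_avg_add continuous_on_add)
        finally show "H \<zeta> \<le> ereal (circle_avg g)"
          by (cases "v (z, \<zeta>)") (auto simp: H_def)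
      qed
    qed
    then show ?thesis by (cases "v (z, \<zeta>0)") (auto simp: H_def)
  qed
  then have "v (z, \<zeta>0) \<le> ereal (h \<zeta>0)" by (rule ereal_le_epsilon2)
  then show ?thesis by (simp add: \<Psi>h)
qed

lemma \<Psi>_bounded:
  assumes "\<And>z. z \<in> S \<Longrightarrow> \<bar>u0 z\<bar> \<le> M" "\<And>z. z \<in> S \<Longrightarrow> \<bar>u1 z\<bar> \<le> M" "p \<in> S \<times> closure annulus"
  shows "\<bar>\<Psi> u0 u1 p\<bar> \<le> M"
proof -
  obtain z \<zeta> where p: "p = (z, \<zeta>)" "z \<in> S" "\<zeta> \<in> closure annulus" using assms(3) by auto
  show ?thesis
    unfolding p(1) \<Psi>_eq using closure_annulus_bounds[OF p(3)] assms(1,2)[OF p(2)] by (intro convex_comb_bounds)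
qed

text \<open>
  The weights \<open>1 - ln |\<zeta>|\<close> and \<open>ln |\<zeta>|\<close> are nonnegative on the annulus, so the upper bounds for \<open>u0\<close> and \<open>u1\<close>
  near \<open>z\<close> can be inserted into \<open>\<Psi>\<close>; what remains is continuous in \<open>\<zeta>\<close>.
\<close>
lemma usc_on_\<Psi>:
  assumes "usc_on \<Omega> (\<lambda>z. ereal (u0 z))" "usc_on \<Omega> (\<lambda>z. ereal (u1 z))"
  shows "usc_on (\<Omega> \<times> annulus) (\<lambda>p. ereal (\<Psi> u0 u1 p))"
proof (rule usc_on_realI)
  fix p and e :: real assume "p \<in> \<Omega> \<times> annulus" and e: "0 < e"
  then obtain z \<zeta> where p: "p = (z, \<zeta>)" "z \<in> \<Omega>" "\<zeta> \<in> annulus" by auto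
  have e2: "0 < e / 2" using e by simp
  obtain U where U: "open U" "z \<in> U" "\<And>y. y \<in> U \<inter> \<Omega> \<Longrightarrow> u0 y < u0 z + e / 2"
    using usc_on_realD[OF assms(1) p(2) e2] by blast
  obtain V where V: "open V" "z \<in> V" "\<And>y. y \<in> V \<inter> \<Omega> \<Longrightarrow> u1 y < u1 z + e / 2"
    using usc_on_realD[OF assms(2) p(2) e2] by blast
  have "continuous_on annulus (\<lambda>\<xi>. \<Psi> u0 u1 (z, \<xi>))"
    unfolding \<Psi>_eq by (intro continuous_intros) (auto simp: mem_annulus)
  from usc_on_realD[OF continuous_imp_usc_on[OF this] p(3) e2] obtain N where
    N: "open N" "\<zeta> \<in> N" "\<And>\<xi>. \<xi> \<in> N \<inter> annulus \<Longrightarrow> \<Psi> u0 u1 (z, \<xi>) < \<Psi> u0 u1 (z, \<zeta>) + e / 2" by blast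
  have "\<Psi> u0 u1 q < \<Psi> u0 u1 p + e" if qN: "q \<in> ((U \<inter> V) \<times> N) \<inter> (\<Omega> \<times> annulus)" for q
  proof -
    obtain y \<xi> where q: "q = (y, \<xi>)" "y \<in> U \<inter> \<Omega>" "y \<in> V \<inter> \<Omega>" "\<xi> \<in> N \<inter> annulus" using qN by auto
    have t: "0 \<le> ln (norm \<xi>)" "0 \<le> 1 - ln (norm \<xi>)" using q(4) by (auto simp: annulus_def)
    have convex_shift: "(1 - t) * (a + d) + t * (b + d) = (1 - t) * a + t * b + d" for t a b d :: real
      by (simp add: algebra_simps)
    have "\<Psi> u0 u1 q = (1 - ln (norm \<xi>)) * u0 y + ln (norm \<xi>) * u1 y" by (simp add: q \<Psi>_def)
    also have "\<dots> \<le> (1 - ln (norm \<xi>)) * (u0 z + e / 2) + ln (norm \<xi>) * (u1 z + e / 2)"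
      using U(3)[OF q(2)] V(3)[OF q(3)] t by (intro add_mono mult_left_mono) auto
    also have "\<dots> = \<Psi> u0 u1 (z, \<xi>) + e / 2" unfolding convex_shift by (simp add: \<Psi>_def)
    also have "\<dots> < \<Psi> u0 u1 p + e" using N(3)[OF q(4)] by (simp add: p)
    finally show ?thesis .
  qed
  then show "\<exists>U. open U \<and> p \<in> U \<and> (\<forall>y\<in>U \<inter> (\<Omega> \<times> annulus). \<Psi> u0 u1 y < \<Psi> u0 u1 p + e)"
    using U V N p by (intro exI[of _ "(U \<inter> V) \<times> N"]) (auto intro!: open_Times)
qed

text \<open>
  Both envelopes coincide with the largest plurisubharmonic minorant \<open>w\<close> of \<open>\<Psi>\<close>. By \<open>W_le_\<Psi>\<close> every element
  of \<open>W\<close> is a minorant of \<open>\<Psi>\<close>. Conversely \<open>w\<close> itself lies in \<open>W\<close>, since \<open>w \<le> \<Psi>\<close> and \<open>\<Psi>\<close> attains the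
  prescribed values on the two circles.
\<close>
lemma upper_envelope_properties:
  fixes \<Omega> :: "(complex ^ 'n) set"
  assumes "open \<Omega>" and usc: "usc_on \<Omega> (\<lambda>z. ereal (u0 z))" "usc_on \<Omega> (\<lambda>z. ereal (u1 z))"
    and M: "\<And>z. z \<in> \<Omega> \<Longrightarrow> \<bar>u0 z\<bar> \<le> M" "\<And>z. z \<in> \<Omega> \<Longrightarrow> \<bar>u1 z\<bar> \<le> M"
  obtains w :: "(complex ^ 'n) \<times> complex \<Rightarrow> real" where
    "\<And>p. p \<in> \<Omega> \<times> annulus \<Longrightarrow> upper_envelope \<Omega> u0 u1 p = ereal (w p)"
    "\<And>p. p \<in> \<Omega> \<times> annulus \<Longrightarrow> psh_envelope (\<Omega> \<times> annulus) (\<lambda>q. ereal (\<Psi> u0 u1 q)) p = ereal (w p)"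
    "psh_on prod_scale (\<Omega> \<times> annulus) (\<lambda>p. ereal (w p))"
    "\<And>p. p \<in> \<Omega> \<times> annulus \<Longrightarrow> \<bar>w p\<bar> \<le> M" "\<And>p. p \<in> \<Omega> \<times> annulus \<Longrightarrow> w p \<le> \<Psi> u0 u1 p"
    "\<And>v p. psh_on prod_scale (\<Omega> \<times> annulus) v \<Longrightarrow> (\<And>q. q \<in> \<Omega> \<times> annulus \<Longrightarrow> v q \<le> ereal (\<Psi> u0 u1 q))
       \<Longrightarrow> p \<in> \<Omega> \<times> annulus \<Longrightarrow> v p \<le> ereal (w p)"
proof -
  let ?D = "\<Omega> \<times> annulus"
  have "open ?D" using assms(1) open_annulus by (rule open_Times)
  moreover have "\<bar>\<Psi> u0 u1 p\<bar> \<le> M" if "p \<in> ?D" for p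
    using that closure_subset by (intro \<Psi>_bounded[of \<Omega>, OF M]) blast+
  ultimately obtain w :: "(complex ^ 'n) \<times> complex \<Rightarrow> real" where w:
    "\<And>p. p \<in> ?D \<Longrightarrow> psh_envelope ?D (\<lambda>q. ereal (\<Psi> u0 u1 q)) p = ereal (w p)"
    "psh_on prod_scale ?D (\<lambda>p. ereal (w p))"
    "\<And>p. p \<in> ?D \<Longrightarrow> \<bar>w p\<bar> \<le> M" "\<And>p. p \<in> ?D \<Longrightarrow> w p \<le> \<Psi> u0 u1 p"
    "\<And>v p. psh_on prod_scale ?D v \<Longrightarrow> (\<And>q. q \<in> ?D \<Longrightarrow> v q \<le> ereal (\<Psi> u0 u1 q)) \<Longrightarrow> p \<in> ?D \<Longrightarrow> v p \<le> ereal (w p)"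
    using psh_envelope_properties[OF _ usc_on_\<Psi>[OF usc], of M] by blast
  have wW: "(\<lambda>p. ereal (w p)) \<in> W \<Omega> u0 u1"
    unfolding W_def
  proof (intro CollectI conjI ballI w(2))
    fix z assume z: "z \<in> \<Omega>"
    have "ereal (w (z, \<zeta>)) \<le> ereal (u0 z + (u1 z - u0 z) * ln (norm \<zeta>))" if "\<zeta> \<in> annulus" for \<zeta>
      using w(4)[of "(z, \<zeta>)"] z that by (simp add: \<Psi>_eq)
    note bound = Limsup_to_circle_bound[OF this]
    show "Limsup (to_circle 0) (\<lambda>\<zeta>. ereal (w (z, \<zeta>))) \<le> ereal (u0 z)"
      using bound[of 0] by simp
    show "Limsup (to_circle 1) (\<lambda>\<zeta>. ereal (w (z, \<zeta>))) \<le> ereal (u1 z)"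
      using bound[of 1] by simp
  qed
  have "upper_envelope \<Omega> u0 u1 p = ereal (w p)" if p: "p \<in> ?D" for p
  proof (rule antisym)
    show "upper_envelope \<Omega> u0 u1 p \<le> ereal (w p)"
      unfolding upper_envelope_def
    proof (rule SUP_least)
      fix v assume v: "v \<in> W \<Omega> u0 u1"
      show "v p \<le> ereal (w p)"
      proof (rule w(5)[OF _ _ p])
        show "psh_on prod_scale ?D v" using v by (simp add: W_def)
        show "v q \<le> ereal (\<Psi> u0 u1 q)" if "q \<in> ?D" for q using W_le_\<Psi>[OF v] that by auto
      qed
    qed
    show "ereal (w p) \<le> upper_envelope \<Omega> u0 u1 p"
      unfolding upper_envelope_def using wW by (rule SUP_upper)
  qed
  then show ?thesis using that w by blast
qed

section \<open>Boundary values and continuity\<close>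

text \<open>
  The shape of all explicit minorants used at the boundary: a plurisubharmonic function of \<open>z\<close> plus a
  function that is harmonic in \<open>\<zeta>\<close>.
\<close>
lemma psh_on_affine_ln:
  fixes u :: "complex ^ 'n \<Rightarrow> real"
  assumes psh: "psh_on (*s) \<Omega> (\<lambda>z. ereal (u z))" and cont: "continuous_on \<Omega> u"
    and B: "\<And>z. z \<in> \<Omega> \<Longrightarrow> \<bar>u z\<bar> \<le> B" and c: "0 \<le> c"
  shows "psh_on prod_scale (\<Omega> \<times> annulus) (\<lambda>p. ereal (c * u (fst p) + (\<alpha> + \<beta> * ln (norm (snd p)))))"
proof (rule psh_onI_continuous)
  show "continuous_on (\<Omega> \<times> annulus) (\<lambda>p. c * u (fst p) + (\<alpha> + \<beta> * ln (norm (snd p))))"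
    by (intro continuous_intros continuous_on_compose2[OF cont]) (auto simp: mem_annulus)
  show "continuous_on UNIV (\<lambda>l. prod_scale l b)" for b :: "(complex ^ 'n) \<times> complex" by (rule continuous_on_prod_scale)
  show "\<bar>c * u (fst p) + (\<alpha> + \<beta> * ln (norm (snd p)))\<bar> \<le> c * B + (\<bar>\<alpha>\<bar> + \<bar>\<beta>\<bar>)" if "p \<in> \<Omega> \<times> annulus" for p
  proof -
    have "\<bar>c * u (fst p)\<bar> \<le> c * B" using that B[of "fst p"] c by (auto simp: abs_mult intro!: mult_left_mono)
    moreover have "\<bar>\<beta> * ln (norm (snd p))\<bar> \<le> \<bar>\<beta>\<bar> * 1"
      unfolding abs_mult using that by (intro mult_left_mono) (auto simp: annulus_def)
    ultimately show ?thesis by linarith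
  qed
  fix a b :: "(complex ^ 'n) \<times> complex"
  assume disc: "a + prod_scale l b \<in> \<Omega> \<times> annulus" if "norm l \<le> 1" for l
  have d1: "fst a + l *s fst b \<in> \<Omega>" and d2: "snd a + l * snd b \<in> annulus" if "norm l \<le> 1" for l
    using disc[OF that] by (auto simp: prod_scale_def mem_Times_iff)
  have nz: "snd a + l * snd b \<noteq> 0" if "norm l \<le> 1" for l using d2[OF that] by (auto simp: mem_annulus)
  note avg = circle_avg_affine_ln_norm[OF nz, where \<alpha> = \<alpha> and \<beta> = \<beta>]
  have cu: "continuous_on (sphere 0 1) (\<lambda>l. u (fst a + l *s fst b))"
    by (rule continuous_on_compose2[OF cont]) (auto intro!: continuous_intros continuous_on_vector_smult d1)
  have "ereal (u (fst a)) \<le> ereal (circle_avg (\<lambda>l. u (fst a + l *s fst b)))"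
    by (rule psh_on_le_circle_avg[where sc = "(*s)" and b = "fst b", OF psh d1 cu]) auto
  then have "c * u (fst a) \<le> c * circle_avg (\<lambda>l. u (fst a + l *s fst b))" using c by (simp add: mult_left_mono)
  then have "c * u (fst a) + (\<alpha> + \<beta> * ln (norm (snd a)))
      \<le> circle_avg (\<lambda>l. c * u (fst a + l *s fst b)) + circle_avg (\<lambda>l. \<alpha> + \<beta> * ln (norm (snd a + l * snd b)))"
    by (simp add: avg circle_avg_cmult)
  also have "\<dots> = circle_avg (\<lambda>l. c * u (fst a + l *s fst b) + (\<alpha> + \<beta> * ln (norm (snd a + l * snd b))))"
    by (intro circle_avg_add[symmetric] avg(2) continuous_on_mult cu continuous_on_const)
  finally show "c * u (fst a) + (\<alpha> + \<beta> * ln (norm (snd a)))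
      \<le> circle_avg (\<lambda>l. c * u (fst (a + prod_scale l b)) + (\<alpha> + \<beta> * ln (norm (snd (a + prod_scale l b)))))"
    by (simp add: prod_scale_def)
qed

text \<open>
  The value at \<open>p\<close> is nonnegative because \<open>\<rho>\<close> is bounded away from its supremum 0 off each neighbourhood of \<open>p\<close>,
  so the supremum can be approached only at \<open>p\<close>.
\<close>
lemma strong_psh_barrier_properties:
  assumes \<rho>: "strong_psh_barrier \<Omega> p \<rho>" and p: "p \<in> closure \<Omega>"
  shows "\<And>z. z \<in> \<Omega> \<Longrightarrow> \<rho> z \<le> 0" "0 \<le> \<rho> p"
    and "0 < r \<Longrightarrow> \<exists>c>0. \<forall>z\<in>\<Omega> - ball p r. \<rho> z \<le> - c"
proof -
  have sup0: "(SUP z\<in>\<Omega>. ereal (\<rho> z)) = 0" and cont: "continuous_on (closure \<Omega>) \<rho>"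
    and sup_neg: "\<And>U. open U \<Longrightarrow> p \<in> U \<Longrightarrow> (SUP z\<in>\<Omega> - U. ereal (\<rho> z)) < 0"
    using \<rho> by (auto simp: strong_psh_barrier_def)
  show nonpos: "\<rho> z \<le> 0" if "z \<in> \<Omega>" for z
    using SUP_upper[OF that, of "\<lambda>z. ereal (\<rho> z)"] by (simp add: sup0)
  show away: "\<exists>c>0. \<forall>z\<in>\<Omega> - ball p r. \<rho> z \<le> - c" if "0 < r" for r
  proof -
    have "(SUP z\<in>\<Omega> - ball p r. ereal (\<rho> z)) < ereal 0"
      using sup_neg[of "ball p r"] that by (simp add: zero_ereal_def)
    then obtain d where d: "(SUP z\<in>\<Omega> - ball p r. ereal (\<rho> z)) < ereal d" "ereal d < ereal 0"
      using ereal_dense2 by blast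
    have "\<rho> z \<le> - (- d)" if "z \<in> \<Omega> - ball p r" for z
      using SUP_upper[OF that, of "\<lambda>z. ereal (\<rho> z)"] d(1) by (metis ereal_less_eq(3) less_imp_le minus_minus order_trans)
    then show ?thesis using d(2) by (intro exI[of _ "- d"]) auto
  qed
  show "0 \<le> \<rho> p"
  proof (rule ccontr)
    assume "\<not> 0 \<le> \<rho> p"
    then have neg: "\<rho> p < 0" by simp
    then obtain r where r: "r > 0" "\<And>z. z \<in> closure \<Omega> \<Longrightarrow> dist z p < r \<Longrightarrow> dist (\<rho> z) (\<rho> p) < - \<rho> p / 2"
      using cont p unfolding continuous_on_iff by (metis half_gt_zero neg_0_less_iff_less)
    obtain c where c: "c > 0" "\<And>z. z \<in> \<Omega> - ball p r \<Longrightarrow> \<rho> z \<le> - c" using away[OF r(1)] by blast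
    have "(SUP z\<in>\<Omega>. ereal (\<rho> z)) \<le> ereal (max (- c) (\<rho> p / 2))"
    proof (rule SUP_least)
      fix z assume z: "z \<in> \<Omega>"
      show "ereal (\<rho> z) \<le> ereal (max (- c) (\<rho> p / 2))"
      proof (cases "z \<in> ball p r")
        case True
        then have "dist (\<rho> z) (\<rho> p) < - \<rho> p / 2" using z closure_subset by (intro r(2)) (auto simp: dist_commute)
        then have "\<rho> z \<le> \<rho> p / 2" unfolding dist_real_def by linarith
        then show ?thesis unfolding ereal_less_eq by (rule max.coboundedI2)
      next
        case False
        then have "\<rho> z \<le> - c" using c(2)[of z] z by simp
        then show ?thesis unfolding ereal_less_eq by (rule max.coboundedI1)
      qed
    qed
    then show False using c(1) neg by (simp add: sup0 zero_ereal_def max_def split: if_splits)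
  qed
qed

text \<open>
  On the circle \<open>ln |\<zeta>| = 0\<close> the minorant \<open>u0 z - 2 M ln |\<zeta>|\<close> attains the boundary values, and symmetrically on
  the other circle. Over a point \<open>z0\<close> of the frontier of \<open>\<Omega>\<close>, take
  \<open>\<Psi> (z0, \<zeta>) - e / 2 + C \<rho> z\<close> with a barrier \<open>\<rho>\<close> at \<open>z0\<close>. Near \<open>z0\<close> it lies below \<open>\<Psi>\<close> because \<open>u0\<close> and \<open>u1\<close> are
  continuous at \<open>z0\<close>; away from \<open>z0\<close> because \<open>\<rho>\<close> is bounded above by some \<open>-c < 0\<close> there and \<open>C = 2 M / c\<close>
  outweighs the oscillation of \<open>\<Psi>\<close>.
\<close>
lemma boundary_minorant:
  fixes \<Omega> :: "(complex ^ 'n) set"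
  assumes \<Omega>: "open \<Omega>"
    and psh: "psh_on (*s) \<Omega> (\<lambda>z. ereal (u0 z))" "psh_on (*s) \<Omega> (\<lambda>z. ereal (u1 z))"
    and cont: "continuous_on (closure \<Omega>) u0" "continuous_on (closure \<Omega>) u1"
    and M: "\<And>z. z \<in> closure \<Omega> \<Longrightarrow> \<bar>u0 z\<bar> \<le> M" "\<And>z. z \<in> closure \<Omega> \<Longrightarrow> \<bar>u1 z\<bar> \<le> M"
    and bounded: "bounded \<Omega>" and B: "B_regular \<Omega>"
    and p: "p \<in> closure (\<Omega> \<times> annulus)" "p \<notin> \<Omega> \<times> annulus" and e: "0 < e"
  obtains g where "continuous_on (closure (\<Omega> \<times> annulus)) g" "psh_on prod_scale (\<Omega> \<times> annulus) (\<lambda>q. ereal (g q))"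
    "\<And>q. q \<in> \<Omega> \<times> annulus \<Longrightarrow> g q \<le> \<Psi> u0 u1 q" "\<Psi> u0 u1 p - e < g p"
proof -
  obtain z0 \<zeta>0 where p_eq: "p = (z0, \<zeta>0)" and z0: "z0 \<in> closure \<Omega>" and \<zeta>0: "\<zeta>0 \<in> closure annulus"
    using p(1) by (auto simp: closure_Times)
  have sub: "z \<in> closure \<Omega>" if "z \<in> \<Omega>" for z using that closure_subset by blast
  have cont': "continuous_on \<Omega> u0" "continuous_on \<Omega> u1"
    using cont closure_subset continuous_on_subset by blast+
  have M0: "0 \<le> M" using M(1)[OF z0] by simp
  have cont_form: "continuous_on (closure (\<Omega> \<times> annulus)) (\<lambda>q. c * u (fst q) + (\<alpha> + \<beta> * ln (norm (snd q))))"
    if "continuous_on (closure \<Omega>) u" for c \<alpha> \<beta> and u :: "complex ^ 'n \<Rightarrow> real"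
    unfolding closure_Times
    by (intro continuous_intros continuous_on_compose2[OF that]) (auto dest: closure_annulus_bounds)
  show ?thesis
  proof (cases "\<zeta>0 \<in> annulus")
    case False
    have "ln (norm \<zeta>0) = 0 \<or> ln (norm \<zeta>0) = 1"
      using False closure_annulus_bounds[OF \<zeta>0] unfolding annulus_def mem_Collect_eq by linarith
    then show ?thesis
    proof
      assume t: "ln (norm \<zeta>0) = 0"
      show ?thesis
      proof (rule that[of "\<lambda>q. 1 * u0 (fst q) + (0 + (- (2 * M)) * ln (norm (snd q)))"])
        show "continuous_on (closure (\<Omega> \<times> annulus)) (\<lambda>q. 1 * u0 (fst q) + (0 + (- (2 * M)) * ln (norm (snd q))))"
          by (rule cont_form[OF cont(1)])
        show "psh_on prod_scale (\<Omega> \<times> annulus) (\<lambda>q. ereal (1 * u0 (fst q) + (0 + (- (2 * M)) * ln (norm (snd q)))))"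
          by (rule psh_on_affine_ln[OF psh(1) cont'(1) M(1)[OF sub]]) auto
        fix q assume "q \<in> \<Omega> \<times> annulus"
        then obtain z \<zeta> where q: "q = (z, \<zeta>)" "z \<in> \<Omega>" "\<zeta> \<in> annulus" by auto
        have "0 \<le> (u1 z - u0 z + 2 * M) * ln (norm \<zeta>)"
          using M[OF sub[OF q(2)]] q(3) by (intro mult_nonneg_nonneg) (auto simp: annulus_def)
        then show "1 * u0 (fst q) + (0 + (- (2 * M)) * ln (norm (snd q))) \<le> \<Psi> u0 u1 q"
          by (simp add: q \<Psi>_eq algebra_simps)
      qed (use e t in \<open>auto simp: p_eq \<Psi>_eq\<close>)
    next
      assume t: "ln (norm \<zeta>0) = 1"
      show ?thesis
      proof (rule that[of "\<lambda>q. 1 * u1 (fst q) + (- (2 * M) + 2 * M * ln (norm (snd q)))"])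
        show "continuous_on (closure (\<Omega> \<times> annulus)) (\<lambda>q. 1 * u1 (fst q) + (- (2 * M) + 2 * M * ln (norm (snd q))))"
          by (rule cont_form[OF cont(2)])
        show "psh_on prod_scale (\<Omega> \<times> annulus) (\<lambda>q. ereal (1 * u1 (fst q) + (- (2 * M) + 2 * M * ln (norm (snd q)))))"
          by (rule psh_on_affine_ln[OF psh(2) cont'(2) M(2)[OF sub]]) auto
        fix q assume "q \<in> \<Omega> \<times> annulus"
        then obtain z \<zeta> where q: "q = (z, \<zeta>)" "z \<in> \<Omega>" "\<zeta> \<in> annulus" by auto
        have "0 \<le> (u0 z - u1 z + 2 * M) * (1 - ln (norm \<zeta>))"
          using M[OF sub[OF q(2)]] q(3) by (intro mult_nonneg_nonneg) (auto simp: annulus_def)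
        then show "1 * u1 (fst q) + (- (2 * M) + 2 * M * ln (norm (snd q))) \<le> \<Psi> u0 u1 q"
          by (simp add: q \<Psi>_eq algebra_simps)
      qed (use e t in \<open>auto simp: p_eq \<Psi>_eq\<close>)
    qed
  next
    case True
    then have "z0 \<in> frontier \<Omega>" using p(2) z0 \<Omega> by (auto simp: p_eq frontier_def interior_open)
    then obtain \<rho> where \<rho>: "strong_psh_barrier \<Omega> z0 \<rho>" using B by (auto simp: B_regular_def)
    note barrier = strong_psh_barrier_properties[OF \<rho> z0]
    have \<rho>_psh: "psh_on (*s) \<Omega> (\<lambda>z. ereal (\<rho> z))" and \<rho>_cont: "continuous_on (closure \<Omega>) \<rho>"
      using \<rho> by (auto simp: strong_psh_barrier_def)
    have "bounded (\<rho> ` closure \<Omega>)"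
      using bounded \<rho>_cont by (intro compact_imp_bounded compact_continuous_image) (auto simp: compact_closure)
    then obtain R where R: "\<And>z. z \<in> closure \<Omega> \<Longrightarrow> \<bar>\<rho> z\<bar> \<le> R" unfolding bounded_iff by auto
    obtain r0 where r0: "r0 > 0" "\<And>z. z \<in> closure \<Omega> \<Longrightarrow> dist z z0 < r0 \<Longrightarrow> \<bar>u0 z - u0 z0\<bar> < e / 2"
      using cont(1) z0 e unfolding continuous_on_iff dist_real_def by (metis half_gt_zero)
    obtain r1 where r1: "r1 > 0" "\<And>z. z \<in> closure \<Omega> \<Longrightarrow> dist z z0 < r1 \<Longrightarrow> \<bar>u1 z - u1 z0\<bar> < e / 2"
      using cont(2) z0 e unfolding continuous_on_iff dist_real_def by (metis half_gt_zero)
    define r where "r = min r0 r1"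
    obtain c where c: "c > 0" "\<And>z. z \<in> \<Omega> - ball z0 r \<Longrightarrow> \<rho> z \<le> - c"
      using barrier(3)[of r] r0(1) r1(1) by (auto simp: r_def)
    define C where "C = 2 * M / c"
    have C0: "0 \<le> C" using M0 c by (simp add: C_def)
    let ?g = "\<lambda>q. C * \<rho> (fst q) + ((u0 z0 - e / 2) + (u1 z0 - u0 z0) * ln (norm (snd q)))"
    show ?thesis
    proof (rule that[of ?g])
      show "continuous_on (closure (\<Omega> \<times> annulus)) ?g" by (rule cont_form[OF \<rho>_cont])
      show "psh_on prod_scale (\<Omega> \<times> annulus) (\<lambda>q. ereal (?g q))"
        by (rule psh_on_affine_ln[OF \<rho>_psh continuous_on_subset[OF \<rho>_cont closure_subset] R[OF sub] C0])
      show "\<Psi> u0 u1 p - e < ?g p"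
        using mult_nonneg_nonneg[OF C0 barrier(2)] e by (simp add: p_eq \<Psi>_eq)
      fix q assume "q \<in> \<Omega> \<times> annulus"
      then obtain z \<zeta> where q: "q = (z, \<zeta>)" "z \<in> \<Omega>" "\<zeta> \<in> annulus" by auto
      define t where "t = ln (norm \<zeta>)"
      have t: "0 \<le> t" "t \<le> 1" using q(3) by (auto simp: annulus_def t_def)
      have "C * \<rho> z + (u0 z0 + (u1 z0 - u0 z0) * t) \<le> u0 z + (u1 z - u0 z) * t + e / 2"
      proof (cases "z \<in> ball z0 r")
        case True
        then have near: "\<bar>u0 z0 - u0 z\<bar> \<le> e / 2" "\<bar>u1 z0 - u1 z\<bar> \<le> e / 2"
          using r0(2)[OF sub[OF q(2)]] r1(2)[OF sub[OF q(2)]] by (auto simp: r_def dist_commute abs_minus_commute less_imp_le)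
        have "C * \<rho> z \<le> 0" using C0 barrier(1)[OF q(2)] by (rule mult_nonneg_nonpos)
        moreover have "\<bar>(u0 z0 - u0 z) + ((u1 z0 - u1 z) - (u0 z0 - u0 z)) * t\<bar> \<le> e / 2"
          by (rule convex_comb_bounds[OF t near])
        then have "(u0 z0 - u0 z) + ((u1 z0 - u1 z) - (u0 z0 - u0 z)) * t \<le> e / 2" by linarith
        then have "u0 z0 + (u1 z0 - u0 z0) * t \<le> u0 z + (u1 z - u0 z) * t + e / 2" by (simp add: algebra_simps)
        ultimately show ?thesis by linarith
      next
        case False
        then have "C * \<rho> z \<le> C * (- c)" using c(2)[of z] q(2) C0 by (intro mult_left_mono) auto
        also have "\<dots> = - (2 * M)" using c(1) by (simp add: C_def)
        finally have "C * \<rho> z \<le> - (2 * M)" .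
        moreover have "\<bar>u0 z0 + (u1 z0 - u0 z0) * t\<bar> \<le> M" by (rule convex_comb_bounds[OF t M[OF z0]])
        moreover have "\<bar>u0 z + (u1 z - u0 z) * t\<bar> \<le> M" by (rule convex_comb_bounds[OF t M[OF sub[OF q(2)]]])
        ultimately show ?thesis using e by linarith
      qed
      then show "?g q \<le> \<Psi> u0 u1 q" by (simp add: q \<Psi>_eq t_def)
    qed
  qed
qed

text \<open>
  The boundary minorants and compactness of the frontier give \<open>\<Psi> - e \<le> w \<le> \<Psi>\<close> uniformly near the frontier of
  the product. This supplies both the continuity at the frontier and the hypothesis of \<open>walsh_translation\<close>,
  whose estimate gives a modulus of continuity inside.
\<close>
lemma continuous_extension_of_envelope:
  fixes \<Omega> :: "(complex ^ 'n) set"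
  assumes \<Omega>: "open \<Omega>" and bounded: "bounded \<Omega>" and B: "B_regular \<Omega>"
    and psh: "psh_on (*s) \<Omega> (\<lambda>z. ereal (u0 z))" "psh_on (*s) \<Omega> (\<lambda>z. ereal (u1 z))"
    and cont: "continuous_on (closure \<Omega>) u0" "continuous_on (closure \<Omega>) u1"
    and w: "psh_on prod_scale (\<Omega> \<times> annulus) (\<lambda>p. ereal (w p))"
      "\<And>p. p \<in> \<Omega> \<times> annulus \<Longrightarrow> \<bar>w p\<bar> \<le> N" "\<And>p. p \<in> \<Omega> \<times> annulus \<Longrightarrow> w p \<le> \<Psi> u0 u1 p"
      "\<And>v p. psh_on prod_scale (\<Omega> \<times> annulus) v \<Longrightarrow> (\<And>q. q \<in> \<Omega> \<times> annulus \<Longrightarrow> v q \<le> ereal (\<Psi> u0 u1 q))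
       \<Longrightarrow> p \<in> \<Omega> \<times> annulus \<Longrightarrow> v p \<le> ereal (w p)"
  shows "continuous_on (closure (\<Omega> \<times> annulus)) (\<lambda>p. if p \<in> \<Omega> \<times> annulus then w p else \<Psi> u0 u1 p)"
proof -
  define D where "D = \<Omega> \<times> annulus"
  define X where "X = closure D"
  define h where "h = \<Psi> u0 u1"
  define \<omega> where "\<omega> p = (if p \<in> D then w p else h p)" for p
  have "open D" unfolding D_def using \<Omega> open_annulus by (rule open_Times)
  have "compact X" unfolding X_def D_def using bounded bounded_annulus by (simp add: compact_closure bounded_Times)
  have DX: "D \<subseteq> X" unfolding X_def by (rule closure_subset)
  have \<omega>_h: "\<omega> p \<le> h p" for p using w(3)[of p] by (auto simp: \<omega>_def h_def D_def)
  have "compact (closure \<Omega>)" using bounded by (simp add: compact_closure)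
  then have "bounded (u0 ` closure \<Omega> \<union> u1 ` closure \<Omega>)"
    using cont by (auto intro!: compact_imp_bounded compact_continuous_image)
  then obtain M where "\<And>x. x \<in> u0 ` closure \<Omega> \<union> u1 ` closure \<Omega> \<Longrightarrow> \<bar>x\<bar> \<le> M"
    unfolding bounded_iff by auto
  then have M: "\<bar>u0 z\<bar> \<le> M" "\<bar>u1 z\<bar> \<le> M" if "z \<in> closure \<Omega>" for z using that by auto
  have h_cont: "continuous_on X h"
    unfolding X_def D_def h_def \<Psi>_def closure_Times
    by (intro continuous_intros continuous_on_compose2[OF cont(1)] continuous_on_compose2[OF cont(2)])
       (auto dest: closure_annulus_bounds)
  have maximal: "v p \<le> w p" if "psh_on prod_scale D (\<lambda>p. ereal (v p))" "\<And>q. q \<in> D \<Longrightarrow> v q \<le> h q" "p \<in> D" for v p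
    using w(4)[of "\<lambda>p. ereal (v p)" p] that by (auto simp: D_def h_def)
  have near_frontier: "\<exists>\<delta>>0. \<forall>p\<in>frontier D. \<forall>q\<in>X. dist q p < \<delta> \<longrightarrow> h q - e \<le> \<omega> q" if e: "e > 0" for e
  proof -
    have "\<exists>d>0. \<forall>q\<in>X. dist q p < d \<longrightarrow> h q - e \<le> \<omega> q" if p: "p \<in> frontier D" for p
    proof -
      have pX: "p \<in> X" "p \<notin> D" using p \<open>open D\<close> by (auto simp: frontier_def X_def interior_open)
      have "0 < e / 2" using e by simp
      from boundary_minorant[OF \<Omega> psh cont M bounded B pX[unfolded X_def D_def] this]
      obtain g where g: "continuous_on X g" "psh_on prod_scale D (\<lambda>q. ereal (g q))"
        "\<And>q. q \<in> D \<Longrightarrow> g q \<le> h q" "h p - e / 2 < g p"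
        unfolding X_def D_def h_def by blast
      have "continuous_on X (\<lambda>q. g q - h q)" by (intro continuous_intros g h_cont)
      then obtain d where d: "d > 0" "\<And>q. q \<in> X \<Longrightarrow> dist q p < d \<Longrightarrow> \<bar>(g q - h q) - (g p - h p)\<bar> < e / 2"
        using pX(1) e unfolding continuous_on_iff dist_real_def by (metis half_gt_zero)
      have "h q - e \<le> \<omega> q" if q: "q \<in> X" "dist q p < d" for q
      proof (cases "q \<in> D")
        case True
        have "h q - e \<le> g q" using d(2)[OF q] g(4) by linarith
        also have "\<dots> \<le> w q" by (rule maximal[OF g(2,3) True])
        finally show ?thesis using True by (simp add: \<omega>_def)
      qed (use e in \<open>simp add: \<omega>_def\<close>)
      then show ?thesis using d(1) by blast
    qed
    then obtain d where d: "\<And>p. p \<in> frontier D \<Longrightarrow> d p > 0"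
      "\<And>p q. p \<in> frontier D \<Longrightarrow> q \<in> X \<Longrightarrow> dist q p < d p \<Longrightarrow> h q - e \<le> \<omega> q" by metis
    have "frontier D \<subseteq> X" by (auto simp: frontier_def X_def)
    then have "compact (frontier D)"
      using \<open>compact X\<close> closed_Int_compact[OF frontier_closed] by (metis inf.absorb1)
    moreover have "frontier D \<subseteq> \<Union> ((\<lambda>p. ball p (d p)) ` frontier D)" using d(1) by auto
    moreover have "\<And>G. G \<in> (\<lambda>p. ball p (d p)) ` frontier D \<Longrightarrow> open G" by auto
    ultimately obtain \<delta> where \<delta>: "\<delta> > 0"
      "\<forall>p\<in>frontier D. \<exists>G\<in>(\<lambda>p. ball p (d p)) ` frontier D. ball p \<delta> \<subseteq> G"
      by (rule Heine_Borel_lemma) auto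
    have "h q - e \<le> \<omega> q" if "p \<in> frontier D" "q \<in> X" "dist q p < \<delta>" for p q
    proof -
      obtain p' where p': "p' \<in> frontier D" "ball p \<delta> \<subseteq> ball p' (d p')" using \<delta>(2) \<open>p \<in> frontier D\<close> by blast
      have "q \<in> ball p \<delta>" using that by (simp add: dist_commute)
      then have "dist q p' < d p'" using p'(2) by (auto simp: dist_commute)
      then show ?thesis using d(2)[OF p'(1) \<open>q \<in> X\<close>] by blast
    qed
    then show ?thesis using \<delta>(1) by blast
  qed
  have "continuous_on X \<omega>"
    unfolding continuous_on_iff
  proof (intro ballI allI impI)
    fix x and e :: real assume x: "x \<in> X" and e: "e > 0"
    \<comment> \<open>The oscillation bound below is \<open>2 * k\<close>, which has to be strictly less than \<open>e\<close>.\<close>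
    define k where "k = e / 3"
    have k: "k > 0" using e by (simp add: k_def)
    obtain \<delta>1 where \<delta>1: "\<delta>1 > 0" "\<And>p q. p \<in> frontier D \<Longrightarrow> q \<in> X \<Longrightarrow> dist q p < \<delta>1 \<Longrightarrow> h q - k \<le> \<omega> q"
      using near_frontier[OF k] by blast
    have "uniformly_continuous_on X h" by (rule compact_uniformly_continuous[OF h_cont \<open>compact X\<close>])
    then obtain \<delta>2 where \<delta>2: "\<delta>2 > 0" "\<And>p q. p \<in> X \<Longrightarrow> q \<in> X \<Longrightarrow> dist q p < \<delta>2 \<Longrightarrow> dist (h q) (h p) < k"
      unfolding uniformly_continuous_on_def using k by metis
    define \<delta> where "\<delta> = min \<delta>1 \<delta>2"
    have hd: "\<bar>h q - h p\<bar> < k" if "p \<in> X" "q \<in> X" "dist q p < \<delta>" for p q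
      using \<delta>2(2)[of p q] that by (simp add: \<delta>_def dist_real_def)
    have frontier_mem: "p \<in> frontier D" if "p \<in> X" "p \<notin> D" for p
      using that \<open>open D\<close> by (simp add: frontier_def X_def interior_open)
    have step: "\<omega> q' \<le> \<omega> q + 2 * k" if q: "q \<in> X" "q' \<in> X" "dist q q' < \<delta>" for q q'
    proof (cases "q \<in> D \<and> q' \<in> D")
      case True
      have "w q' \<le> w q + 2 * k"
      proof (rule walsh_translation[where sc = prod_scale and D = D and h = h and \<delta> = \<delta> and M = N])
        show "h q - k \<le> w q" if "q \<in> D" "p \<in> frontier D" "dist q p < \<delta>" for q p
          using \<delta>1(2)[of p q] that DX by (auto simp: \<delta>_def \<omega>_def)
        show "h q' \<le> h q + k" if "q \<in> D" "q' \<in> D" "dist q q' < \<delta>" for q q'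
        proof -
          have "\<bar>h q - h q'\<bar> < k" using that DX by (intro hd) auto
          then show ?thesis by linarith
        qed
        show "continuous_on UNIV (\<lambda>l. prod_scale l b)" for b :: "(complex ^ 'n) \<times> complex"
          by (rule continuous_on_prod_scale)
      qed (use \<open>open D\<close> w maximal k True q in \<open>auto simp: D_def h_def prod_scale_add prod_scale_mult\<close>)
      then show ?thesis using True by (simp add: \<omega>_def)
    next
      case False
      have "h q - k \<le> \<omega> q"
      proof (cases "q \<in> D")
        case True
        then have "q' \<in> frontier D" using False frontier_mem q by blast
        then show ?thesis using \<delta>1(2) q by (simp add: \<delta>_def)
      qed (use k in \<open>simp add: \<omega>_def\<close>)
      moreover have "\<bar>h q - h q'\<bar> < k" using hd[of q' q] q by simp
      moreover have "\<omega> q' \<le> h q'" by (rule \<omega>_h)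
      ultimately show ?thesis by linarith
    qed
    show "\<exists>d>0. \<forall>x'\<in>X. dist x' x < d \<longrightarrow> dist (\<omega> x') (\<omega> x) < e"
    proof (intro exI[of _ \<delta>] conjI ballI impI)
      show "\<delta> > 0" using \<delta>1 \<delta>2 by (simp add: \<delta>_def)
      fix x' assume x': "x' \<in> X" "dist x' x < \<delta>"
      have "\<omega> x \<le> \<omega> x' + 2 * k" using step[of x' x] x x' by simp
      moreover have "\<omega> x' \<le> \<omega> x + 2 * k" using step[of x x'] x x' by (simp add: dist_commute)
      ultimately show "dist (\<omega> x') (\<omega> x) < e" using e unfolding dist_real_def k_def by linarith
    qed
  qed
  then show ?thesis unfolding X_def D_def h_def \<omega>_def[abs_def] .
qed

theorem theoremA:
  fixes \<Omega> :: "(complex ^ 'n) set" and u0 u1 :: "complex ^ 'n \<Rightarrow> real"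
  assumes "domain \<Omega>" and "bounded \<Omega>" and "hyperconvex \<Omega>"
    and "(\<lambda>z. ereal (u0 z)) \<in> PSH \<Omega>" and "bounded (u0 ` \<Omega>)"
    and "(\<lambda>z. ereal (u1 z)) \<in> PSH \<Omega>" and "bounded (u1 ` \<Omega>)"
  shows "(\<forall>p\<in>\<Omega> \<times> annulus.
            upper_envelope \<Omega> u0 u1 p = psh_envelope (\<Omega> \<times> annulus) (\<lambda>q. ereal (\<Psi> u0 u1 q)) p) \<and>
         (continuous_on (closure \<Omega>) u0 \<and> continuous_on (closure \<Omega>) u1 \<and> B_regular \<Omega> \<longrightarrow>
            (\<exists>w :: (complex ^ 'n) \<times> complex \<Rightarrow> real.
               continuous_on (closure (\<Omega> \<times> annulus)) w \<and>
               (\<forall>p\<in>\<Omega> \<times> annulus. upper_envelope \<Omega> u0 u1 p = ereal (w p)) \<and>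
               (\<forall>p\<in>frontier \<Omega> \<times> annulus. w p = \<Psi> u0 u1 p)))"
proof -
  have "open \<Omega>" using assms(1) by (simp add: domain_def)
  have psh: "psh_on (*s) \<Omega> (\<lambda>z. ereal (u0 z))" "psh_on (*s) \<Omega> (\<lambda>z. ereal (u1 z))"
    using assms(4,6) by auto
  then have usc: "usc_on \<Omega> (\<lambda>z. ereal (u0 z))" "usc_on \<Omega> (\<lambda>z. ereal (u1 z))" by (simp_all add: psh_on_def)
  have "bounded (u0 ` \<Omega> \<union> u1 ` \<Omega>)" using assms(5,7) by simp
  then obtain M where "\<And>x. x \<in> u0 ` \<Omega> \<union> u1 ` \<Omega> \<Longrightarrow> \<bar>x\<bar> \<le> M" unfolding bounded_iff by auto
  then have M: "\<bar>u0 z\<bar> \<le> M" "\<bar>u1 z\<bar> \<le> M" if "z \<in> \<Omega>" for z using that by auto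
  obtain w :: "(complex ^ 'n) \<times> complex \<Rightarrow> real" where w:
    "\<And>p. p \<in> \<Omega> \<times> annulus \<Longrightarrow> upper_envelope \<Omega> u0 u1 p = ereal (w p)"
    "\<And>p. p \<in> \<Omega> \<times> annulus \<Longrightarrow> psh_envelope (\<Omega> \<times> annulus) (\<lambda>q. ereal (\<Psi> u0 u1 q)) p = ereal (w p)"
    "psh_on prod_scale (\<Omega> \<times> annulus) (\<lambda>p. ereal (w p))"
    "\<And>p. p \<in> \<Omega> \<times> annulus \<Longrightarrow> \<bar>w p\<bar> \<le> M" "\<And>p. p \<in> \<Omega> \<times> annulus \<Longrightarrow> w p \<le> \<Psi> u0 u1 p"
    "\<And>v p. psh_on prod_scale (\<Omega> \<times> annulus) v \<Longrightarrow> (\<And>q. q \<in> \<Omega> \<times> annulus \<Longrightarrow> v q \<le> ereal (\<Psi> u0 u1 q))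
       \<Longrightarrow> p \<in> \<Omega> \<times> annulus \<Longrightarrow> v p \<le> ereal (w p)"
    using upper_envelope_properties[OF \<open>open \<Omega>\<close> usc M] by blast
  show ?thesis
  proof (intro conjI ballI impI)
    show "upper_envelope \<Omega> u0 u1 p = psh_envelope (\<Omega> \<times> annulus) (\<lambda>q. ereal (\<Psi> u0 u1 q)) p"
      if "p \<in> \<Omega> \<times> annulus" for p using w(1,2)[OF that] by simp
    assume "continuous_on (closure \<Omega>) u0 \<and> continuous_on (closure \<Omega>) u1 \<and> B_regular \<Omega>"
    then have "continuous_on (closure (\<Omega> \<times> annulus)) (\<lambda>p. if p \<in> \<Omega> \<times> annulus then w p else \<Psi> u0 u1 p)"
      by (intro continuous_extension_of_envelope[where N = M] \<open>open \<Omega>\<close> assms(2) psh w(3,4,5)) (auto intro: w(6))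
    moreover have "p \<notin> \<Omega> \<times> annulus" if "p \<in> frontier \<Omega> \<times> annulus" for p
      using that \<open>open \<Omega>\<close> by (auto simp: frontier_def interior_open)
    ultimately show "\<exists>w. continuous_on (closure (\<Omega> \<times> annulus)) w \<and>
        (\<forall>p\<in>\<Omega> \<times> annulus. upper_envelope \<Omega> u0 u1 p = ereal (w p)) \<and>
        (\<forall>p\<in>frontier \<Omega> \<times> annulus. w p = \<Psi> u0 u1 p)"
      using w(1) by (intro exI[of _ "\<lambda>p. if p \<in> \<Omega> \<times> annulus then w p else \<Psi> u0 u1 p"]) auto
  qed
qed

end
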